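(* Let $N\in\mathbb{N}$, $T>0$, let $c_2,c_{1,1},\dots,c_{1,N}\in C([0,T];\mathbb{R})$ and consider $$\widetilde P=D_t-ic_2(t)\Delta_x+\sum_{j=1}^N i\,c_{1,j}(t)D_{x_j}.$$ Suppose there exist $t^\star\in[0,T]$ and $\delta>0$ with $[t^\star,t^\star+\delta]\subset[0,T]$ such that - $c_2\equiv0$ in $[t^\star,t^\star+\delta]$; - $c_{1,j}\not\equiv0$ in $[t^\star,t^\star+\delta]$ for some $j\in\{1,2,\dots,N\}$. Then there exist $f\in C([0,T];C^\omega(\mathbb{T}^N))$ and $g\in C^\omega(\mathbb{T}^N)$ for which there is no solution in $C([0,T];C^\omega(\mathbb{T}^N))$ of the Cauchy problem $\widetilde Pu(t,x)=f(t,x)$, $u(0,x)=g(x)$, $t\in[0,T]$, $x\in\mathbb{T}^N$.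
   Context: $\mathbb{T}^N=\mathbb{R}^N/2\pi\mathbb{Z}^N$, $D_t=\frac1i\partial_t$, $D_{x_j}=\frac1i\partial_{x_j}$, $\Delta_x=\sum_j\partial_{x_j}^2$. $C^\omega(\mathbb{T}^N)$ is the space of $f\in C^\infty(\mathbb{T}^N)$ for which there are $C,h>0$ with $|D^\alpha f(x)|\le Ch^{|\alpha|}|\alpha|!$ for all multi-indices $\alpha$ and all $x$. With $\|f\|_{h}=\sup_\alpha \|D^\alpha f\|_\infty/(h^{|\alpha|}|\alpha|!)$, it carries the (locally convex) inductive limit topology of the Banach spaces $\{f:\|f\|_{h}<\infty\}$, $h\to\infty$. $C([0,T];X)$ denotes the continuous maps $[0,T]\to X$. A function $u\in C([0,T];C^\omega(\mathbb{T}^N))$ solves the Cauchy problem if $u(0)=g$ and $\widetilde Pu=f$ holds with $D_tu$ understood as the weak derivative in $t$ on $(0,T)$: $\langle D_tu,\varphi\rangle=\int_0^T u(t)(-D_t\varphi(t))\,dt$ for $\varphi\in C_c^\infty((0,T))$. *)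

theory Defs
  imports "HOL-Analysis.Analysis"
begin

section \<open>Smooth functions on the torus\<close>

text \<open>Functions on the torus are functions on \<open>real ^ 'n\<close> that are \<open>2 * pi\<close>-periodic in every
  coordinate; the dimension is \<open>CARD('n)\<close>, so it is at least 1.\<close>

definition partial_deriv :: "'n::finite \<Rightarrow> (real ^ 'n \<Rightarrow> complex) \<Rightarrow> real ^ 'n \<Rightarrow> complex" where
  "partial_deriv j f x = vector_derivative (\<lambda>s. f (x + s *\<^sub>R axis j 1)) (at 0)"

definition Dx :: "'n::finite \<Rightarrow> (real ^ 'n \<Rightarrow> complex) \<Rightarrow> real ^ 'n \<Rightarrow> complex" where
  "Dx j f x = (1 / \<i>) * partial_deriv j f x"

definition laplacian :: "(real ^ 'n::finite \<Rightarrow> complex) \<Rightarrow> real ^ 'n \<Rightarrow> complex" where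
  "laplacian f x = (\<Sum>j\<in>UNIV. partial_deriv j (partial_deriv j f) x)"

text \<open>\<open>vector_derivative\<close> is total, so existence of each iterated partial derivative is
  required explicitly, along every word \<open>js\<close> of coordinate directions.\<close>

definition smooth :: "(real ^ 'n::finite \<Rightarrow> complex) \<Rightarrow> bool" where
  "smooth f \<longleftrightarrow> (\<forall>js. continuous_on UNIV (foldr partial_deriv js f) \<and>
     (\<forall>j x. (\<lambda>s. foldr partial_deriv js f (x + s *\<^sub>R axis j 1)) differentiable (at 0)))"

definition Cinf_torus :: "(real ^ 'n::finite \<Rightarrow> complex) set" where
  "Cinf_torus = {f. smooth f \<and> (\<forall>j x. f (x + (2 * pi) *\<^sub>R axis j 1) = f x)}"

text \<open>Multi-indices are functions \<open>'n \<Rightarrow> nat\<close>. The coordinates are enumerated once and for all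
  in order to compose the powers \<open>Dx j ^^ \<alpha> j\<close>; on smooth functions the order is irrelevant.\<close>

definition coords :: "'n::finite list" where
  "coords = (SOME js. distinct js \<and> set js = UNIV)"

definition Dmulti :: "('n::finite \<Rightarrow> nat) \<Rightarrow> (real ^ 'n \<Rightarrow> complex) \<Rightarrow> real ^ 'n \<Rightarrow> complex" where
  "Dmulti \<alpha> f = foldr (\<lambda>j. Dx j ^^ \<alpha> j) coords f"

definition msize :: "('n::finite \<Rightarrow> nat) \<Rightarrow> nat" where
  "msize \<alpha> = (\<Sum>j\<in>UNIV. \<alpha> j)"


section \<open>The space of real analytic functions on the torus\<close>

definition Comega :: "(real ^ 'n::finite \<Rightarrow> complex) set" where
  "Comega = {f \<in> Cinf_torus. \<exists>C>0. \<exists>h>0. \<forall>\<alpha> x.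
     cmod (Dmulti \<alpha> f x) \<le> C * h ^ msize \<alpha> * fact (msize \<alpha>)}"

definition omega_norm :: "real \<Rightarrow> (real ^ 'n::finite \<Rightarrow> complex) \<Rightarrow> ennreal" where
  "omega_norm h f = (SUP \<alpha>. (SUP x. ennreal (cmod (Dmulti \<alpha> f x))) /
     ennreal (h ^ msize \<alpha> * fact (msize \<alpha>)))"

definition omega_step :: "real \<Rightarrow> (real ^ 'n::finite \<Rightarrow> complex) set" where
  "omega_step h = {f \<in> Cinf_torus. omega_norm h f < \<infinity>}"

definition abs_convex :: "('a \<Rightarrow> complex) set \<Rightarrow> bool" where
  "abs_convex V \<longleftrightarrow> (\<forall>f\<in>V. \<forall>g\<in>V. \<forall>a b. cmod a + cmod b \<le> 1 \<longrightarrow> (\<lambda>x. a * f x + b * g x) \<in> V)"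

lemma foldr_partial_deriv_lincomb:
  assumes "smooth f" "smooth g"
  shows "foldr partial_deriv js (\<lambda>x. a * f x + b * g x) =
    (\<lambda>x. a * foldr partial_deriv js f x + b * foldr partial_deriv js g x)"
proof (induction js)
  case (Cons j js)
  show ?case
  proof
    fix x
    let ?F = "\<lambda>s. foldr partial_deriv js f (x + s *\<^sub>R axis j 1)"
    let ?G = "\<lambda>s. foldr partial_deriv js g (x + s *\<^sub>R axis j 1)"
    have F: "(?F has_vector_derivative partial_deriv j (foldr partial_deriv js f) x) (at 0)"
      using assms(1) unfolding smooth_def partial_deriv_def vector_derivative_works[symmetric] by blast
    have G: "(?G has_vector_derivative partial_deriv j (foldr partial_deriv js g) x) (at 0)"
      using assms(2) unfolding smooth_def partial_deriv_def vector_derivative_works[symmetric] by blast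
    have "((\<lambda>s. a * ?F s + b * ?G s) has_vector_derivative
        (a * partial_deriv j (foldr partial_deriv js f) x + b * partial_deriv j (foldr partial_deriv js g) x)) (at 0)"
      by (intro has_vector_derivative_add has_vector_derivative_mult_right F G)
    from vector_derivative_at[OF this]
    show "foldr partial_deriv (j # js) (\<lambda>x. a * f x + b * g x) x =
        a * foldr partial_deriv (j # js) f x + b * foldr partial_deriv (j # js) g x"
      unfolding foldr_Cons comp_def Cons.IH
      by (simp add: partial_deriv_def[of j "\<lambda>x. a * foldr partial_deriv js f x + b * foldr partial_deriv js g x"])
  qed
qed simp

lemma smooth_lincomb:
  assumes "smooth f" "smooth g"
  shows "smooth (\<lambda>x. a * f x + b * g x)"
proof -
  have "(\<lambda>s. a * foldr partial_deriv js f (x + s *\<^sub>R axis j 1) +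
      b * foldr partial_deriv js g (x + s *\<^sub>R axis j 1)) differentiable (at 0)" for js j x
    using assms unfolding smooth_def by (intro differentiable_add differentiable_mult) auto
  moreover have "continuous_on UNIV (\<lambda>x. a * foldr partial_deriv js f x + b * foldr partial_deriv js g x)" for js
    using assms unfolding smooth_def by (intro continuous_intros) auto
  ultimately show ?thesis
    using assms unfolding smooth_def[of "\<lambda>x. a * f x + b * g x"] by (simp add: foldr_partial_deriv_lincomb)
qed

lemma foldr_Dx:
  assumes "smooth f"
  shows "foldr Dx js f = (\<lambda>x. (1 / \<i>) ^ length js * foldr partial_deriv js f x)"
proof (induction js)
  case (Cons j js)
  show ?case
  proof
    fix x
    let ?F = "\<lambda>s. foldr partial_deriv js f (x + s *\<^sub>R axis j 1)"
    have F: "(?F has_vector_derivative partial_deriv j (foldr partial_deriv js f) x) (at 0)"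
      using assms unfolding smooth_def partial_deriv_def vector_derivative_works[symmetric] by blast
    have "((\<lambda>s. (1 / \<i>) ^ length js * ?F s) has_vector_derivative
        ((1 / \<i>) ^ length js * partial_deriv j (foldr partial_deriv js f) x)) (at 0)"
      by (intro has_vector_derivative_mult_right F)
    from vector_derivative_at[OF this]
    show "foldr Dx (j # js) f x = (1 / \<i>) ^ length (j # js) * foldr partial_deriv (j # js) f x"
      by (simp add: Cons.IH Dx_def partial_deriv_def[of j "\<lambda>x. _ x"] partial_deriv_def[of j "foldr _ _ _"])
  qed
qed simp

lemma Dmulti_eq_foldr: "Dmulti \<alpha> f = foldr Dx (concat (map (\<lambda>j. replicate (\<alpha> j) j) coords)) f"
proof -
  have rep: "foldr Dx (replicate n j) h = (Dx j ^^ n) h" for n j and h :: "real ^ 'a \<Rightarrow> complex"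
    by (induction n) auto
  have "foldr (\<lambda>j. Dx j ^^ \<alpha> j) js f = foldr Dx (concat (map (\<lambda>j. replicate (\<alpha> j) j) js)) f" for js
    by (induction js) (simp_all add: rep)
  then show ?thesis unfolding Dmulti_def .
qed

lemma Dmulti_lincomb:
  assumes "smooth f" "smooth g"
  shows "Dmulti \<alpha> (\<lambda>x. a * f x + b * g x) = (\<lambda>x. a * Dmulti \<alpha> f x + b * Dmulti \<alpha> g x)"
  unfolding Dmulti_eq_foldr foldr_Dx[OF assms(1)] foldr_Dx[OF assms(2)] foldr_Dx[OF smooth_lincomb[OF assms]]
    foldr_partial_deriv_lincomb[OF assms] by (simp add: algebra_simps)

lemma Comega_lincomb:
  assumes "f \<in> Comega" "g \<in> Comega"
  shows "(\<lambda>x. a * f x + b * g x) \<in> Comega"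
proof -
  obtain C h where f: "f \<in> Cinf_torus" "C > 0" "h > 0"
    "\<And>\<alpha> x. cmod (Dmulti \<alpha> f x) \<le> C * h ^ msize \<alpha> * fact (msize \<alpha>)"
    using assms(1) unfolding Comega_def by blast
  obtain D k where g: "g \<in> Cinf_torus" "D > 0" "k > 0"
    "\<And>\<alpha> x. cmod (Dmulti \<alpha> g x) \<le> D * k ^ msize \<alpha> * fact (msize \<alpha>)"
    using assms(2) unfolding Comega_def by blast
  have sm: "smooth f" "smooth g" using f g unfolding Cinf_torus_def by auto
  let ?C = "cmod a * C + cmod b * D + 1" and ?h = "max h k"
  have "cmod (Dmulti \<alpha> (\<lambda>x. a * f x + b * g x) x) \<le> ?C * ?h ^ msize \<alpha> * fact (msize \<alpha>)" for \<alpha> x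
  proof -
    let ?m = "msize \<alpha>"
    have "h ^ ?m \<le> ?h ^ ?m" "k ^ ?m \<le> ?h ^ ?m"
      using f(3) g(3) by (auto intro!: power_mono)
    then have "C * h ^ ?m * fact ?m \<le> C * ?h ^ ?m * fact ?m" "D * k ^ ?m * fact ?m \<le> D * ?h ^ ?m * fact ?m"
      using f(2) g(2) by (auto intro!: mult_right_mono mult_left_mono)
    then have "cmod (Dmulti \<alpha> f x) \<le> C * ?h ^ ?m * fact ?m" "cmod (Dmulti \<alpha> g x) \<le> D * ?h ^ ?m * fact ?m"
      using f(4) g(4) order_trans by blast+
    then have "cmod a * cmod (Dmulti \<alpha> f x) + cmod b * cmod (Dmulti \<alpha> g x) \<le>
        cmod a * (C * ?h ^ ?m * fact ?m) + cmod b * (D * ?h ^ ?m * fact ?m)"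
      by (intro add_mono mult_left_mono) auto
    also have "\<dots> \<le> ?C * ?h ^ ?m * fact ?m"
      using f(3) by (simp add: algebra_simps)
    finally show ?thesis
      unfolding Dmulti_lincomb[OF sm]
      by (meson norm_triangle_le norm_mult order_trans order_refl add_mono norm_mult_ineq)
  qed
  moreover have "?C > 0" "?h > 0" using f g by (auto intro!: add_nonneg_pos)
  moreover have "(\<lambda>x. a * f x + b * g x) \<in> Cinf_torus"
    using f(1) g(1) smooth_lincomb[OF sm] unfolding Cinf_torus_def by simp
  ultimately show ?thesis unfolding Comega_def by blast
qed

lemma omega_norm_le_iff:
  assumes "h > 0" "C \<ge> 0"
  shows "omega_norm h f \<le> ennreal C \<longleftrightarrow>
    (\<forall>\<alpha> x. cmod (Dmulti \<alpha> f x) \<le> C * h ^ msize \<alpha> * fact (msize \<alpha>))"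
proof -
  have "(SUP x. ennreal (cmod (Dmulti \<alpha> f x))) / ennreal (h ^ msize \<alpha> * fact (msize \<alpha>)) \<le> ennreal C \<longleftrightarrow>
      (\<forall>x. cmod (Dmulti \<alpha> f x) \<le> C * h ^ msize \<alpha> * fact (msize \<alpha>))" for \<alpha>
  proof -
    let ?d = "h ^ msize \<alpha> * fact (msize \<alpha>)"
    have d: "?d > 0" using assms by simp
    have "(SUP x. ennreal (cmod (Dmulti \<alpha> f x))) / ennreal ?d \<le> ennreal C \<longleftrightarrow>
        (SUP x. ennreal (cmod (Dmulti \<alpha> f x))) \<le> ennreal C * ennreal ?d"
      (is "?a / _ \<le> _ \<longleftrightarrow> _")
    proof
      assume "?a / ennreal ?d \<le> ennreal C"
      then have "?a / ennreal ?d * ennreal ?d \<le> ennreal C * ennreal ?d" by (rule mult_right_mono) simp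
      moreover have "?a / ennreal ?d * ennreal ?d = ?a"
      proof -
        have "?a / ennreal ?d * ennreal ?d = ennreal ?d * (?a / ennreal ?d)" by (rule mult.commute)
        also have "\<dots> = ?a * ennreal ?d / ennreal ?d" unfolding ennreal_times_divide by (simp only: mult.commute)
        also have "\<dots> = ?a" using assms(1) by (intro ennreal_mult_divide_eq) auto
        finally show ?thesis .
      qed
      ultimately show "?a \<le> ennreal C * ennreal ?d" by simp
    next
      assume "?a \<le> ennreal C * ennreal ?d"
      then show "?a / ennreal ?d \<le> ennreal C" using d by (intro divide_le_posI_ennreal) (auto simp: mult.commute)
    qed
    also have "\<dots> \<longleftrightarrow> (\<forall>x. ennreal (cmod (Dmulti \<alpha> f x)) \<le> ennreal (C * ?d))"
      using assms d by (simp add: SUP_le_iff ennreal_mult)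
    finally show ?thesis using assms d by (simp add: mult.assoc)
  qed
  then show ?thesis unfolding omega_norm_def SUP_le_iff by simp
qed

lemma Comega_eq_Union_steps: "Comega = (\<Union>h\<in>{0<..}. omega_step h)"
proof (intro equalityI subsetI)
  fix f :: "real ^ 'a \<Rightarrow> complex" assume "f \<in> Comega"
  then obtain C h where f: "f \<in> Cinf_torus" "C > 0" "h > 0"
    "\<forall>\<alpha> x. cmod (Dmulti \<alpha> f x) \<le> C * h ^ msize \<alpha> * fact (msize \<alpha>)"
    unfolding Comega_def by blast
  then have "omega_norm h f \<le> ennreal C" using omega_norm_le_iff[of h C f] by simp
  then have "f \<in> omega_step h"
    using f(1) unfolding omega_step_def by (auto intro: le_less_trans)
  then show "f \<in> (\<Union>h\<in>{0<..}. omega_step h)" using f(3) by blast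
next
  fix f :: "real ^ 'a \<Rightarrow> complex" assume "f \<in> (\<Union>h\<in>{0<..}. omega_step h)"
  then obtain h where h: "h > 0" "f \<in> Cinf_torus" "omega_norm h f < \<infinity>"
    unfolding omega_step_def by auto
  define C where "C = enn2real (omega_norm h f) + 1"
  have C: "C > 0" unfolding C_def by (simp add: add_nonneg_pos)
  have "omega_norm h f = ennreal (enn2real (omega_norm h f))" using h(3) by simp
  also have "\<dots> \<le> ennreal C" unfolding C_def by (intro ennreal_leI) simp
  finally have "\<forall>\<alpha> x. cmod (Dmulti \<alpha> f x) \<le> C * h ^ msize \<alpha> * fact (msize \<alpha>)"
    using omega_norm_le_iff[of h C f] h(1) C by simp
  then show "f \<in> Comega" using h(1,2) C unfolding Comega_def by blast
qed

text \<open>The neighbourhood base of 0 of the locally convex inductive limit topology: absolutely convex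
  sets whose trace on every step is a neighbourhood of 0 in that Banach space. This is the finest
  locally convex topology that makes all the inclusions of the steps continuous.\<close>

definition Comega_nhd0 :: "(real ^ 'n::finite \<Rightarrow> complex) set \<Rightarrow> bool" where
  "Comega_nhd0 V \<longleftrightarrow> V \<subseteq> Comega \<and> abs_convex V \<and>
     (\<forall>h>0. \<exists>\<epsilon>>0. {f \<in> omega_step h. omega_norm h f < ennreal \<epsilon>} \<subseteq> V)"

definition Comega_topology :: "(real ^ 'n::finite \<Rightarrow> complex) topology" where
  "Comega_topology = topology (\<lambda>U. U \<subseteq> Comega \<and>
     (\<forall>f\<in>U. \<exists>V. Comega_nhd0 V \<and> (\<forall>v\<in>V. (\<lambda>x. f x + v x) \<in> U)))"

lemma Comega_nhd0_Int:
  assumes "Comega_nhd0 V" "Comega_nhd0 W"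
  shows "Comega_nhd0 (V \<inter> W)"
proof -
  have "\<exists>\<epsilon>>0. {f \<in> omega_step h. omega_norm h f < ennreal \<epsilon>} \<subseteq> V \<inter> W" if hpos: "h > 0" for h
  proof -
    obtain e where e: "e > 0" "{f \<in> omega_step h. omega_norm h f < ennreal e} \<subseteq> V"
      using assms(1) hpos unfolding Comega_nhd0_def by meson
    obtain d where d: "d > 0" "{f \<in> omega_step h. omega_norm h f < ennreal d} \<subseteq> W"
      using assms(2) hpos unfolding Comega_nhd0_def by meson
    have le: "ennreal (min e d) \<le> ennreal e" "ennreal (min e d) \<le> ennreal d"
      by (auto intro: ennreal_leI)
    have "{f \<in> omega_step h. omega_norm h f < ennreal (min e d)} \<subseteq> V \<inter> W"
      using e(2) d(2) le by (auto dest: less_le_trans)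
    then show ?thesis using e(1) d(1) by (intro exI[of _ "min e d"]) auto
  qed
  moreover have "abs_convex (V \<inter> W)"
    using assms unfolding Comega_nhd0_def abs_convex_def by blast
  moreover have "V \<inter> W \<subseteq> Comega" using assms(1) unfolding Comega_nhd0_def by blast
  ultimately show ?thesis unfolding Comega_nhd0_def by blast
qed

lemma openin_Comega_topology:
  fixes U :: "(real ^ 'n::finite \<Rightarrow> complex) set"
  shows "openin Comega_topology U \<longleftrightarrow> U \<subseteq> Comega \<and>
     (\<forall>f\<in>U. \<exists>V. Comega_nhd0 V \<and> (\<forall>v\<in>V. (\<lambda>x. f x + v x) \<in> U))"
proof -
  let ?P = "\<lambda>U :: (real ^ 'n \<Rightarrow> complex) set. U \<subseteq> Comega \<and>
     (\<forall>f\<in>U. \<exists>V. Comega_nhd0 V \<and> (\<forall>v\<in>V. (\<lambda>x. f x + v x) \<in> U))"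
  have "?P (S \<inter> T)" if "?P S" "?P T" for S T
  proof (intro conjI ballI)
    show "S \<inter> T \<subseteq> Comega" using that by blast
    fix f assume "f \<in> S \<inter> T"
    then obtain V W where "Comega_nhd0 V" "\<forall>v\<in>V. (\<lambda>x. f x + v x) \<in> S"
      "Comega_nhd0 W" "\<forall>v\<in>W. (\<lambda>x. f x + v x) \<in> T" using \<open>?P S\<close> \<open>?P T\<close> by blast
    then show "\<exists>V. Comega_nhd0 V \<and> (\<forall>v\<in>V. (\<lambda>x. f x + v x) \<in> S \<inter> T)"
      by (intro exI[of _ "V \<inter> W"]) (auto intro: Comega_nhd0_Int)
  qed
  moreover have "?P (\<Union>K)" if "\<forall>S\<in>K. ?P S" for K
    using that by (meson Sup_least UnionE UnionI)
  ultimately have "istopology ?P" unfolding istopology_def by blast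
  from topology_inverse'[OF this] show ?thesis unfolding Comega_topology_def by simp
qed

lemma topspace_Comega_topology: "topspace Comega_topology = Comega"
proof -
  have "abs_convex Comega" unfolding abs_convex_def by (simp add: Comega_lincomb)
  moreover have "\<exists>\<epsilon>>0. {f \<in> omega_step h. omega_norm h f < ennreal \<epsilon>} \<subseteq> Comega" if "h > 0" for h
    using that unfolding Comega_eq_Union_steps by (intro exI[of _ 1]) auto
  ultimately have "Comega_nhd0 Comega" unfolding Comega_nhd0_def by blast
  moreover have "(\<lambda>x. f x + v x) \<in> Comega" if "f \<in> Comega" "v \<in> Comega" for f v
    using Comega_lincomb[OF that, of 1 1] by simp
  ultimately have "openin Comega_topology Comega" unfolding openin_Comega_topology by blast
  then show ?thesis
    by (metis openin_Comega_topology openin_subset openin_topspace subset_antisym)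
qed


section \<open>The Cauchy problem\<close>

text \<open>\<open>C([0,T]; Comega)\<close>; only the values of \<open>u\<close> on \<open>{0..T}\<close> matter.\<close>

definition C_Comega :: "real \<Rightarrow> (real \<Rightarrow> real ^ 'n::finite \<Rightarrow> complex) set" where
  "C_Comega T = {u. continuous_map (top_of_set {0..T}) Comega_topology u}"

definition test_fun :: "real \<Rightarrow> (real \<Rightarrow> complex) set" where
  "test_fun T = {\<phi>. (\<forall>n t. ((\<lambda>\<psi> s. vector_derivative \<psi> (at s)) ^^ n) \<phi> differentiable (at t)) \<and>
     compact (closure {t. \<phi> t \<noteq> 0}) \<and> closure {t. \<phi> t \<noteq> 0} \<subseteq> {0<..<T}}"

definition Dt :: "(real \<Rightarrow> complex) \<Rightarrow> real \<Rightarrow> complex" where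
  "Dt \<phi> t = (1 / \<i>) * vector_derivative \<phi> (at t)"

text \<open>The distribution on \<open>(0,T)\<close> given by a continuous \<open>Comega\<close>-valued function. Point evaluations
  are continuous on \<open>Comega\<close> and separate points, so the vector-valued integral of
  \<open>\<lambda>t. \<phi> t * w t\<close> is the function obtained by integrating pointwise in \<open>x\<close>.\<close>

definition distr :: "real \<Rightarrow> (real \<Rightarrow> real ^ 'n::finite \<Rightarrow> complex) \<Rightarrow>
    (real \<Rightarrow> complex) \<Rightarrow> real ^ 'n \<Rightarrow> complex" where
  "distr T w \<phi> = (\<lambda>x. integral {0..T} (\<lambda>t. w t x * \<phi> t))"

definition weak_Dt :: "real \<Rightarrow> (real \<Rightarrow> real ^ 'n::finite \<Rightarrow> complex) \<Rightarrow>
    (real \<Rightarrow> complex) \<Rightarrow> real ^ 'n \<Rightarrow> complex" where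
  "weak_Dt T u \<phi> = distr T u (\<lambda>t. - Dt \<phi> t)"

definition spatial_part :: "(real \<Rightarrow> real) \<Rightarrow> ('n::finite \<Rightarrow> real \<Rightarrow> real) \<Rightarrow> real \<Rightarrow>
    (real ^ 'n \<Rightarrow> complex) \<Rightarrow> real ^ 'n \<Rightarrow> complex" where
  "spatial_part c2 c1 t v x =
     - \<i> * of_real (c2 t) * laplacian v x + (\<Sum>j\<in>UNIV. \<i> * of_real (c1 j t) * Dx j v x)"

definition P_tilde :: "real \<Rightarrow> (real \<Rightarrow> real) \<Rightarrow> ('n::finite \<Rightarrow> real \<Rightarrow> real) \<Rightarrow>
    (real \<Rightarrow> real ^ 'n \<Rightarrow> complex) \<Rightarrow> (real \<Rightarrow> complex) \<Rightarrow> real ^ 'n \<Rightarrow> complex" where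
  "P_tilde T c2 c1 u \<phi> =
     (\<lambda>x. weak_Dt T u \<phi> x + distr T (\<lambda>t. spatial_part c2 c1 t (u t)) \<phi> x)"

definition solves_Cauchy :: "real \<Rightarrow> (real \<Rightarrow> real) \<Rightarrow> ('n::finite \<Rightarrow> real \<Rightarrow> real) \<Rightarrow>
    (real \<Rightarrow> real ^ 'n \<Rightarrow> complex) \<Rightarrow> (real ^ 'n \<Rightarrow> complex) \<Rightarrow>
    (real \<Rightarrow> real ^ 'n \<Rightarrow> complex) \<Rightarrow> bool" where
  "solves_Cauchy T c2 c1 f g u \<longleftrightarrow> u \<in> C_Comega T \<and> u 0 = g \<and>
     (\<forall>\<phi>\<in>test_fun T. P_tilde T c2 c1 u \<phi> = distr T f \<phi>)"

end

theory Submission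
  imports Defs
begin

text \<open>
  Take \<open>g = 0\<close> and the time-independent right-hand side \<open>f(t,x) = F(x) = \<Sum>n. q\<^sup>n exp(i n \<sigma> x\<^sub>j)\<close> with
  \<open>q = exp(-\<rho>)\<close>, where on an interval \<open>[a,b] \<subseteq> [t\<^sup>\<star>, t\<^sup>\<star> + \<delta>]\<close> we have \<open>c\<^sub>2 = 0\<close> and \<open>\<sigma> c\<^sub>1\<^sub>j \<ge> \<eta> > 0\<close> for a sign
  \<open>\<sigma> = \<plusminus>1\<close>. The Fourier coefficient \<open>U\<^sub>n\<close> of a solution at the frequency \<open>n \<sigma> e\<^sub>j\<close> satisfies
  \<open>U\<^sub>n' = (c\<^sub>2 n\<^sup>2 + c\<^sub>1\<^sub>j n \<sigma>) U\<^sub>n + i q\<^sup>n V\<close> with \<open>V\<close> the volume of the torus and \<open>U\<^sub>n(0) = 0\<close>. The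
  source has a constant sign, so there is no cancellation, whatever the coefficients do before \<open>a\<close>: for the
  midpoint \<open>c\<close> of \<open>[a,b]\<close>, what is produced on \<open>[a,c]\<close> is amplified on \<open>[c,b]\<close> by at least
  \<open>exp(n \<eta> (b - c))\<close>, and \<open>|U\<^sub>n(b)| \<ge> (c - a) V exp(n (\<eta> (b - c) - \<rho>))\<close>. For small \<open>\<rho>\<close> this is unbounded
  in \<open>n\<close>, although the Fourier coefficients of the continuous function \<open>u(b)\<close> are bounded.
\<close>

section \<open>Functions with a weak derivative in time\<close>

text \<open>The polynomial parameter makes the family closed under differentiation;
  \<open>p = 1\<close> gives the classical smooth function that is flat at 0.\<close>

definition flat :: "real poly \<Rightarrow> real \<Rightarrow> real" where
  "flat p t = (if t > 0 then poly p (inverse t) * exp (- inverse t) else 0)"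

lemma poly_div_exp_tendsto_0:
  fixes p :: "real poly"
  shows "((\<lambda>x. poly p x / exp x) \<longlongrightarrow> 0) at_top"
proof -
  have "((\<lambda>x. \<Sum>i\<le>degree p. coeff p i * (x ^ i / exp x)) \<longlongrightarrow> (\<Sum>i\<le>degree p. coeff p i * 0)) at_top"
    by (intro tendsto_intros tendsto_power_div_exp_0)
  then show ?thesis
    by (simp add: poly_altdef sum_divide_distrib)
qed

text \<open>With x = 1/t, differentiating p(x) exp(-x) in t yields x^2 (p - p')(x) exp(-x), which is
  again of the form \<open>flat\<close>. At 0 the exponential beats every polynomial.\<close>

lemma flat_has_real_derivative:
  "(flat p has_real_derivative flat ([:0, 0, 1:] * (p - pderiv p)) t) (at t)"
proof -
  consider "t > 0" | "t < 0" | "t = 0" by linarith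
  then show ?thesis
  proof cases
    case 1
    have "((\<lambda>t. poly p (inverse t) * exp (- inverse t)) has_real_derivative
        flat ([:0, 0, 1:] * (p - pderiv p)) t) (at t)"
      using 1 by (auto intro!: derivative_eq_intros poly_DERIV[THEN DERIV_chain2]
          simp: flat_def power2_eq_square algebra_simps)
    moreover have "\<forall>\<^sub>F s in nhds t. flat p s = poly p (inverse s) * exp (- inverse s)"
      using eventually_nhds_in_open[of "{0<..}" t] 1 by (auto simp: flat_def elim!: eventually_mono)
    ultimately show ?thesis by (subst DERIV_cong_ev[OF refl _ refl])
  next
    case 2
    have "\<forall>\<^sub>F s in nhds t. flat p s = 0"
      using eventually_nhds_in_open[of "{..<0}" t] 2 by (auto simp: flat_def elim!: eventually_mono)
    moreover have "flat ([:0, 0, 1:] * (p - pderiv p)) t = 0" using 2 by (simp add: flat_def)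
    ultimately show ?thesis by (subst DERIV_cong_ev[OF refl, of _ "\<lambda>_. 0"]) auto
  next
    case 3
    \<comment> \<open>The difference quotient at 0 divides by s, that is, multiplies by x = 1/s;
      this turns \<open>p\<close> into \<open>pCons 0 p\<close>.\<close>
    have "((\<lambda>s. poly (pCons 0 p) (inverse s) / exp (inverse s)) \<longlongrightarrow> 0) (at_right 0)"
      using poly_div_exp_tendsto_0 filterlim_inverse_at_top_right by (rule filterlim_compose)
    then have "((\<lambda>s. flat p s / s) \<longlongrightarrow> 0) (at_right 0)"
      by (rule Lim_transform_eventually)
        (auto simp: eventually_at_right_less flat_def exp_minus field_simps intro!: eventually_at_rightI[of 0 1])
    moreover have "((\<lambda>s. flat p s / s) \<longlongrightarrow> 0) (at_left 0)"
      by (rule Lim_transform_eventually[OF tendsto_const])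
        (auto simp: flat_def intro!: eventually_at_leftI[of "-1" 0])
    ultimately have "((\<lambda>s. flat p s / s) \<longlongrightarrow> 0) (at 0)"
      by (simp add: filterlim_at_split)
    with 3 show ?thesis
      by (simp add: has_field_derivative_iff flat_def)
  qed
qed

text \<open>A class of functions that contains a smooth step and is closed under differentiation, so that
  all its members are smooth.\<close>

inductive_set flat_algebra :: "(real \<Rightarrow> complex) set" where
  const: "(\<lambda>_. c) \<in> flat_algebra"
| flat: "(\<lambda>t. of_real (flat p (a * t + b))) \<in> flat_algebra"
| add: "f \<in> flat_algebra \<Longrightarrow> g \<in> flat_algebra \<Longrightarrow> (\<lambda>t. f t + g t) \<in> flat_algebra"
| mult: "f \<in> flat_algebra \<Longrightarrow> g \<in> flat_algebra \<Longrightarrow> (\<lambda>t. f t * g t) \<in> flat_algebra"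
| inverse: "f \<in> flat_algebra \<Longrightarrow> (\<And>t. f t \<noteq> 0) \<Longrightarrow> (\<lambda>t. inverse (f t)) \<in> flat_algebra"

text \<open>Rule induction: the differentiation rule for each constructor is an expression in the
  same constructors.\<close>

lemma flat_algebra_has_vector_derivative:
  assumes "f \<in> flat_algebra"
  shows "\<exists>f'\<in>flat_algebra. \<forall>t. (f has_vector_derivative f' t) (at t)"
  using assms
proof induction
  case (const c)
  show ?case by (intro bexI[of _ "\<lambda>_. 0"]) (auto intro: flat_algebra.const)
next
  case (flat p a b)
  let ?q = "[:0, 0, 1:] * (p - pderiv p)"
  have "((\<lambda>t. flat p (a * t + b)) has_real_derivative flat ?q (a * t + b) * a) (at t)" for t
    by (rule DERIV_chain2[OF flat_has_real_derivative]) (auto intro!: derivative_eq_intros)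
  \<comment> \<open>The inner derivative \<open>a\<close> is absorbed into the polynomial, so that
    the derivative is literally an instance of the constructor \<open>flat\<close>.\<close>
  moreover have "flat (smult a ?q) s = flat ?q s * a" for s by (simp add: flat_def)
  ultimately have "((\<lambda>t. of_real (flat p (a * t + b)) :: complex) has_vector_derivative
      of_real (flat (smult a ?q) (a * t + b))) (at t)" for t
    by (intro has_vector_derivative_of_real) (simp only: has_real_derivative_iff_has_vector_derivative)
  then show ?case
    by (intro bexI[OF _ flat_algebra.flat[of "smult a ?q" a b]]) simp
next
  case (add f g)
  then obtain f' g' where "f' \<in> flat_algebra" "\<forall>t. (f has_vector_derivative f' t) (at t)"
    "g' \<in> flat_algebra" "\<forall>t. (g has_vector_derivative g' t) (at t)" by blast
  then show ?case
    by (intro bexI[of _ "\<lambda>t. f' t + g' t"]) (auto intro: flat_algebra.add has_vector_derivative_add)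
next
  case (mult f g)
  then obtain f' g' where "f' \<in> flat_algebra" "\<forall>t. (f has_vector_derivative f' t) (at t)"
    "g' \<in> flat_algebra" "\<forall>t. (g has_vector_derivative g' t) (at t)" by blast
  then show ?case using mult.hyps
    by (intro bexI[of _ "\<lambda>t. f t * g' t + f' t * g t"])
      (auto intro!: flat_algebra.add flat_algebra.mult has_vector_derivative_mult)
next
  case (inverse f)
  then obtain f' where f': "f' \<in> flat_algebra" "\<forall>t. (f has_vector_derivative f' t) (at t)" by blast
  have "((\<lambda>t. inverse (f t)) has_vector_derivative - 1 * f' t * (inverse (f t) * inverse (f t))) (at t)" for t
  proof -
    have "(inverse has_field_derivative - (inverse (f t) * inverse (f t))) (at (f t))"
      using DERIV_inverse[OF inverse.hyps(2)[of t]] by (simp add: power2_eq_square)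
    from field_vector_diff_chain_at[OF f'(2)[rule_format] this]
    show ?thesis by (simp add: o_def)
  qed
  moreover have "(\<lambda>t. - 1 * f' t * (inverse (f t) * inverse (f t))) \<in> flat_algebra"
    by (intro flat_algebra.mult flat_algebra.const flat_algebra.inverse inverse.hyps f')
  ultimately show ?case
    by (intro bexI[of _ "\<lambda>t. - 1 * f' t * (inverse (f t) * inverse (f t))"]) blast+
qed

text \<open>This is smoothness in the form that \<open>test_fun\<close> demands. The induction
  generalizes over \<open>f\<close>, because the innermost derivative is another member of the
  class.\<close>

lemma flat_algebra_iterate_differentiable:
  assumes "f \<in> flat_algebra"
  shows "((\<lambda>\<psi> s. vector_derivative \<psi> (at s)) ^^ n) f differentiable (at t)"
  using assms
proof (induction n arbitrary: f)
  case 0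
  then show ?case
    using flat_algebra_has_vector_derivative[of f] by (auto intro: differentiableI_vector)
next
  case (Suc n)
  obtain f' where "f' \<in> flat_algebra" "\<forall>t. (f has_vector_derivative f' t) (at t)"
    using flat_algebra_has_vector_derivative[OF Suc.prems] by blast
  moreover from this have "(\<lambda>s. vector_derivative f (at s)) = f'"
    by (auto intro!: vector_derivative_at)
  ultimately show ?case using Suc.IH[of f'] by (simp only: funpow_Suc_right o_def)
qed

text \<open>The usual quotient e(t) / (e(t) + e(1 - t)) with e = \<open>flat 1\<close>; its
  denominator is positive because t or 1 - t is. Affine arguments are included so that shifts and
  rescalings remain in the class.\<close>

lemma smooth_step_exists:
  obtains S where "\<And>a b. (\<lambda>t. S (a * t + b)) \<in> flat_algebra"
    "\<And>t. t \<le> 0 \<Longrightarrow> S t = 0" "\<And>t. t \<ge> 1 \<Longrightarrow> S t = 1"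
proof
  define S :: "real \<Rightarrow> complex" where
    "S t = of_real (flat 1 t) * inverse (of_real (flat 1 t) + of_real (flat 1 (1 - t)))" for t
  have "flat 1 t + flat 1 (1 - t) > 0" for t
    by (cases "t > 0") (auto simp: flat_def add_pos_nonneg)
  then have nz: "complex_of_real (flat 1 t) + of_real (flat 1 (1 - t)) \<noteq> 0" for t
    by (metis of_real_add of_real_eq_0_iff less_irrefl)
  have aff: "1 - (a * t + b) = (- a) * t + (1 - b)" for a b t :: real by simp
  show "(\<lambda>t. S (a * t + b)) \<in> flat_algebra" for a b
    unfolding S_def
    apply (intro flat_algebra.mult flat_algebra.inverse flat_algebra.flat flat_algebra.add nz)
    unfolding aff by (rule flat_algebra.flat)
  show "S t = 0" if "t \<le> 0" for t using that by (simp add: S_def flat_def)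
  show "S t = 1" if "t \<ge> 1" for t
    using that by (simp add: S_def flat_def)
qed

section \<open>Approximate identities\<close>

lemma has_vector_derivative_rescale:
  fixes S :: "real \<Rightarrow> complex"
  assumes "\<And>t. (S has_vector_derivative S' t) (at t)"
  shows "((\<lambda>t. S ((t - c) / \<epsilon>)) has_vector_derivative of_real (1 / \<epsilon>) * S' ((t - c) / \<epsilon>)) (at t)"
proof -
  have "((\<lambda>t. (t - c) / \<epsilon>) has_vector_derivative 1 / \<epsilon>) (at t)"
    by (cases "\<epsilon> = 0")
      (auto intro!: derivative_eq_intros simp flip: has_real_derivative_iff_has_vector_derivative)
  from vector_diff_chain_at[OF this assms] show ?thesis
    by (simp add: o_def scaleR_conv_of_real)
qed

text \<open>The rescaled derivative of a step lives on [a, a + \<epsilon>], has integral 1 by the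
  fundamental theorem, and is bounded by B / \<epsilon> with B a bound for \<open>S'\<close>. Once V
  is within e / B of V(a) there, the error is at most \<epsilon> times e / \<epsilon>.\<close>

lemma step_kernel_approx:
  fixes V :: "real \<Rightarrow> complex"
  assumes S': "\<And>t. (S has_vector_derivative S' t) (at t)" "continuous_on UNIV S'"
    and S: "\<And>t. t \<le> 0 \<Longrightarrow> S t = 0" "\<And>t. t \<ge> 1 \<Longrightarrow> S t = 1"
    and V: "continuous_on {0..T} V" and a: "0 < a" "a < T" and "e > 0"
  shows "\<forall>\<^sub>F \<epsilon> in at_right 0.
    cmod (integral {0..T} (\<lambda>t. V t * (of_real (1 / \<epsilon>) * S' ((t - a) / \<epsilon>))) - V a) \<le> e"
proof -
  have S'0: "S' t = 0" if "t < 0 \<or> t > 1" for t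
  proof -
    have "(S has_vector_derivative 0) (at t)"
    proof (rule has_vector_derivative_transform_within_open[of "\<lambda>_. S t" _ _ "if t < 0 then {..<0} else {1<..}"])
    qed (use that in \<open>auto simp: S split: if_splits\<close>)
    with S'(1)[of t] show ?thesis by (rule vector_derivative_unique_at)
  qed
  have "bounded (S' ` {0..1})"
    by (intro compact_imp_bounded compact_continuous_image continuous_on_subset[OF S'(2)]) auto
  then obtain B where B: "B > 0" "\<And>t. t \<in> {0..1} \<Longrightarrow> cmod (S' t) \<le> B"
    unfolding bounded_pos by auto
  have "continuous (at a within {0..T}) V" using V a by (auto simp: continuous_on_eq_continuous_within)
  then obtain d where d: "d > 0" "\<And>t. t \<in> {0..T} \<Longrightarrow> dist t a < d \<Longrightarrow> dist (V t) (V a) < e / B"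
    unfolding continuous_within_eps_delta using \<open>e > 0\<close> B(1) by (metis divide_pos_pos)
  have "\<forall>\<^sub>F \<epsilon> in at_right (0::real). 0 < \<epsilon> \<and> \<epsilon> < min d (T - a)"
    using d(1) a by (intro eventually_at_rightI[of 0 "min d (T - a)"]) auto
  then show ?thesis
  proof (rule eventually_mono, elim conjE)
    fix \<epsilon> :: real assume eps: "0 < \<epsilon>" "\<epsilon> < min d (T - a)"
    let ?k = "\<lambda>t. of_real (1 / \<epsilon>) * S' ((t - a) / \<epsilon>)"
    have ck: "continuous_on A ?k" for A
      by (intro continuous_intros continuous_on_compose2[OF S'(2)]) (use eps in auto)
    have sub: "{a..a+\<epsilon>} \<subseteq> {0..T}" using eps a by auto
    have "?k t = 0" if "t \<notin> {a..a+\<epsilon>}" for t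
      using that eps S'0[of "(t - a) / \<epsilon>"] by (auto simp: field_simps)
    then have restrict: "integral {0..T} (\<lambda>t. V t * ?k t) = integral {a..a+\<epsilon>} (\<lambda>t. V t * ?k t)"
      using sub by (intro integral_spike_set[symmetric] empty_imp_negligible) force+
    have "(?k has_integral S ((a + \<epsilon> - a) / \<epsilon>) - S ((a - a) / \<epsilon>)) {a..a+\<epsilon>}"
    proof (rule fundamental_theorem_of_calculus)
      show "((\<lambda>t. S ((t - a) / \<epsilon>)) has_vector_derivative ?k t) (at t within {a..a+\<epsilon>})" for t
        by (rule has_vector_derivative_at_within[OF has_vector_derivative_rescale[OF S'(1)]])
    qed (use eps in auto)
    then have "(?k has_integral 1) {a..a+\<epsilon>}" using eps by (simp add: S)
    then have Va: "((\<lambda>t. V a * ?k t) has_integral V a) {a..a+\<epsilon>}"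
      using has_integral_mult_right[of ?k 1 "{a..a+\<epsilon>}" "V a"] by simp
    have Vt: "((\<lambda>t. V t * ?k t) has_integral integral {a..a+\<epsilon>} (\<lambda>t. V t * ?k t)) {a..a+\<epsilon>}"
      by (intro integrable_integral integrable_continuous_real continuous_on_mult ck
          continuous_on_subset[OF V] sub)
    have I: "((\<lambda>t. (V t - V a) * ?k t) has_integral
        (integral {0..T} (\<lambda>t. V t * ?k t) - V a)) {a..a+\<epsilon>}"
      unfolding restrict left_diff_distrib by (rule has_integral_diff[OF Vt Va])
    have bd: "cmod ((V t - V a) * ?k t) \<le> e / \<epsilon>" if "t \<in> {a..a+\<epsilon>}" for t
    proof -
      have "cmod (V t - V a) \<le> e / B" using d(2)[of t] that sub eps
        by (force simp: dist_norm)
      moreover have "cmod (?k t) \<le> B / \<epsilon>" using B(2)[of "(t - a) / \<epsilon>"] that eps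
        by (auto simp: norm_mult norm_divide divide_right_mono)
      ultimately have "cmod ((V t - V a) * ?k t) \<le> (e / B) * (B / \<epsilon>)"
        unfolding norm_mult using B eps \<open>e > 0\<close> by (intro mult_mono) auto
      then show ?thesis using B by simp
    qed
    have "cmod (integral {0..T} (\<lambda>t. V t * ?k t) - V a) \<le> e / \<epsilon> * measure lborel {a..a+\<epsilon>}"
      by (rule has_integral_bound_real[OF _ finite.emptyI I]) (use eps \<open>e > 0\<close> bd in auto)
    then show "cmod (integral {0..T} (\<lambda>t. V t * ?k t) - V a) \<le> e" using eps by simp
  qed
qed

text \<open>One step stays at 1 on the right; subtracting a later one cuts it off and leaves a
  smooth plateau supported in [a, b + \<epsilon>].\<close>

lemma test_fun_step_difference:
  assumes S: "\<And>a b. (\<lambda>t. S (a * t + b)) \<in> flat_algebra"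
    "\<And>t. t \<le> 0 \<Longrightarrow> S t = 0" "\<And>t. t \<ge> 1 \<Longrightarrow> S t = 1"
    and "0 < a" "a < b" "b + \<epsilon> < T" "0 < \<epsilon>"
  shows "(\<lambda>t. S ((t - a) / \<epsilon>) - S ((t - b) / \<epsilon>)) \<in> test_fun T"
proof -
  let ?\<phi> = "\<lambda>t. S ((t - a) / \<epsilon>) - S ((t - b) / \<epsilon>)"
  have "(\<lambda>t. S ((1 / \<epsilon>) * t + (- a / \<epsilon>)) + (- 1) * S ((1 / \<epsilon>) * t + (- b / \<epsilon>))) \<in> flat_algebra"
    by (intro flat_algebra.add flat_algebra.mult flat_algebra.const S(1))
  then have "?\<phi> \<in> flat_algebra" by (simp add: diff_divide_distrib)
  moreover have "{t. ?\<phi> t \<noteq> 0} \<subseteq> {a..b+\<epsilon>}"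
  proof (rule subsetI, rule ccontr)
    fix t assume "t \<in> {t. ?\<phi> t \<noteq> 0}" and t: "t \<notin> {a..b+\<epsilon>}"
    have "(t - a) / \<epsilon> \<le> 0 \<and> (t - b) / \<epsilon> \<le> 0 \<or> (t - a) / \<epsilon> \<ge> 1 \<and> (t - b) / \<epsilon> \<ge> 1"
      using t assms(4-) by (auto simp: field_simps)
    then have "?\<phi> t = 0" by (auto simp: S)
    with \<open>t \<in> {t. ?\<phi> t \<noteq> 0}\<close> show False by simp
  qed
  then have "closure {t. ?\<phi> t \<noteq> 0} \<subseteq> {a..b+\<epsilon>}" by (simp add: closure_minimal)
  moreover from this have "compact (closure {t. ?\<phi> t \<noteq> 0})"
    unfolding compact_eq_bounded_closed using bounded_closed_interval bounded_subset by blast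
  ultimately show ?thesis
    unfolding test_fun_def using assms(4-)
    by (auto intro: flat_algebra_iterate_differentiable simp del: right_minus_eq)
qed

section \<open>From weak derivatives to integral equations\<close>

lemma test_fun_has_vector_derivative:
  assumes "\<phi> \<in> test_fun T"
  shows "(\<phi> has_vector_derivative vector_derivative \<phi> (at t)) (at t)"
  using assms unfolding test_fun_def by (auto dest!: spec[of _ "0::nat"] simp: vector_derivative_works)

lemma test_fun_continuous:
  assumes "\<phi> \<in> test_fun T"
  shows "continuous_on A \<phi>" "continuous_on A (\<lambda>t. vector_derivative \<phi> (at t))"
proof -
  show "continuous_on A \<phi>"
    using test_fun_has_vector_derivative[OF assms] 
    by (meson continuous_at_imp_continuous_on has_vector_derivative_continuous)
  have "(\<lambda>t. vector_derivative \<phi> (at t)) differentiable (at t)" for t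
    using assms unfolding test_fun_def by (auto dest!: spec[of _ "Suc 0"])
  then show "continuous_on A (\<lambda>t. vector_derivative \<phi> (at t))"
    by (meson continuous_at_imp_continuous_on differentiable_imp_continuous_within)
qed

lemma test_fun_boundary:
  assumes "\<phi> \<in> test_fun T"
  shows "\<phi> 0 = 0" "\<phi> T = 0"
  using assms closure_subset[of "{t. \<phi> t \<noteq> 0}"] unfolding test_fun_def by force+

text \<open>The derivative of a plateau rising at a and falling at b approximates the difference of
  the Dirac measures at a and b, so V(a) = V(b) for interior points. Continuity extends this to the
  closed interval.\<close>

lemma du_Bois_Reymond:
  fixes V :: "real \<Rightarrow> complex"
  assumes "T > 0" and V: "continuous_on {0..T} V"
    and weak: "\<And>\<phi>. \<phi> \<in> test_fun T \<Longrightarrow> integral {0..T} (\<lambda>t. V t * vector_derivative \<phi> (at t)) = 0"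
    and "t \<in> {0..T}"
  shows "V t = V 0"
proof -
  obtain S where S: "\<And>a b. (\<lambda>t. S (a * t + b)) \<in> flat_algebra"
    "\<And>t. t \<le> 0 \<Longrightarrow> S t = 0" "\<And>t. t \<ge> 1 \<Longrightarrow> S t = 1"
    using smooth_step_exists by blast
  have "S \<in> flat_algebra" using S(1)[of 1 0] by simp
  then obtain S' where S'in: "S' \<in> flat_algebra" and S': "\<And>t. (S has_vector_derivative S' t) (at t)"
    using flat_algebra_has_vector_derivative by blast
  have cS': "continuous_on UNIV S'"
    using flat_algebra_has_vector_derivative[OF S'in]
    by (meson continuous_at_imp_continuous_on has_vector_derivative_continuous)
  have eq: "V a = V b" if ab: "0 < a" "a < b" "b < T" for a b
  proof (rule ccontr)
    assume "V a \<noteq> V b"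
    \<comment> \<open>Two errors of size \<open>e\<close> add up to less than |V(a) - V(b)| =
      3e.\<close>
    define e where "e = cmod (V a - V b) / 3"
    have e: "e > 0" using \<open>V a \<noteq> V b\<close> by (simp add: e_def)
    let ?I = "\<lambda>\<epsilon> c. integral {0..T} (\<lambda>t. V t * (of_real (1 / \<epsilon>) * S' ((t - c) / \<epsilon>)))"
    have "\<forall>\<^sub>F \<epsilon> in at_right 0. cmod (?I \<epsilon> a - V a) \<le> e"
      by (rule step_kernel_approx[OF S' cS' S(2,3) V]) (use ab e in auto)
    moreover have "\<forall>\<^sub>F \<epsilon> in at_right 0. cmod (?I \<epsilon> b - V b) \<le> e"
      by (rule step_kernel_approx[OF S' cS' S(2,3) V]) (use ab e in auto)
    moreover have "\<forall>\<^sub>F \<epsilon> in at_right (0::real). 0 < \<epsilon> \<and> \<epsilon> < T - b"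
      using ab by (intro eventually_at_rightI[of 0 "T - b"]) auto
    ultimately have "\<forall>\<^sub>F \<epsilon> in at_right 0. cmod (?I \<epsilon> a - V a) \<le> e \<and> cmod (?I \<epsilon> b - V b) \<le> e
        \<and> 0 < \<epsilon> \<and> \<epsilon> < T - b"
      by eventually_elim auto
    then obtain \<epsilon> where eps: "cmod (?I \<epsilon> a - V a) \<le> e" "cmod (?I \<epsilon> b - V b) \<le> e" "0 < \<epsilon>" "\<epsilon> < T - b"
      using eventually_happens'[OF trivial_limit_at_right_real] by blast
    note der = has_vector_derivative_rescale[OF S']
    have int: "(\<lambda>t. V t * (of_real (1 / \<epsilon>) * S' ((t - c) / \<epsilon>))) integrable_on {0..T}" for c
      by (intro integrable_continuous_real continuous_intros V continuous_on_compose2[OF cS']) (use eps in auto)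
    let ?\<phi> = "\<lambda>t. S ((t - a) / \<epsilon>) - S ((t - b) / \<epsilon>)"
    have "vector_derivative ?\<phi> (at t) =
        of_real (1 / \<epsilon>) * S' ((t - a) / \<epsilon>) - of_real (1 / \<epsilon>) * S' ((t - b) / \<epsilon>)" for t
      by (intro vector_derivative_at has_vector_derivative_diff der)
    moreover have "?\<phi> \<in> test_fun T"
      by (intro test_fun_step_difference S) (use ab eps in auto)
    ultimately have "integral {0..T} (\<lambda>t. V t * (of_real (1 / \<epsilon>) * S' ((t - a) / \<epsilon>))
        - V t * (of_real (1 / \<epsilon>) * S' ((t - b) / \<epsilon>))) = 0"
      using weak[of ?\<phi>] by (simp only: right_diff_distrib)
    then have "?I \<epsilon> a = ?I \<epsilon> b"
      unfolding integral_diff[OF int[of a] int[of b]] by (rule right_minus_eq[THEN iffD1])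
    then have "V a - V b = (?I \<epsilon> b - V b) - (?I \<epsilon> a - V a)" by (simp only: algebra_simps)
    then have "cmod (V a - V b) \<le> cmod (?I \<epsilon> b - V b) + cmod (?I \<epsilon> a - V a)"
      by (simp only: norm_triangle_ineq4)
    also have "\<dots> \<le> 2 * e" using eps by simp
    finally show False using e by (simp add: e_def)
  qed
  have mid: "V s = V (T / 2)" if "s \<in> {0<..<T}" for s
  proof (cases s "T / 2" rule: linorder_cases)
    case less
    then show ?thesis by (intro eq) (use that \<open>T > 0\<close> in auto)
  next
    case greater
    then show ?thesis by (intro eq[symmetric]) (use that \<open>T > 0\<close> in auto)
  next
    case equal
    then show ?thesis by (rule arg_cong)
  qed
  have "closure {0<..<T} = {0..T}" using \<open>T > 0\<close> by simp
  then have const: "V s = V (T / 2)" if "s \<in> {0..T}" for s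
    using that V by (intro continuous_constant_on_closure[where S = "{0<..<T}", OF _ mid]) simp_all
  show ?thesis
    by (rule trans[OF const const[symmetric]]) (use \<open>t \<in> {0..T}\<close> \<open>T > 0\<close> in auto)
qed

text \<open>Integration by parts, with vanishing boundary terms, shows that U minus the primitive of
  G has weak derivative 0; hence it is constant.\<close>

lemma weak_derivative_imp_integral:
  fixes U G :: "real \<Rightarrow> complex"
  assumes "T > 0" and U: "continuous_on {0..T} U" and G: "continuous_on {0..T} G"
    and weak: "\<And>\<phi>. \<phi> \<in> test_fun T \<Longrightarrow>
      integral {0..T} (\<lambda>t. U t * vector_derivative \<phi> (at t)) + integral {0..T} (\<lambda>t. G t * \<phi> t) = 0"
    and "t \<in> {0..T}"
  shows "U t = U 0 + integral {0..t} G"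
proof -
  define I where "I t = integral {0..t} G" for t
  have dI: "(I has_vector_derivative G t) (at t within {0..T})" if "t \<in> {0..T}" for t
    unfolding I_def by (rule integral_has_vector_derivative[OF G that])
  then have cI: "continuous_on {0..T} I"
    by (meson continuous_on_eq_continuous_within has_vector_derivative_continuous)
  have "U t - I t = U 0 - I 0"
  proof (rule du_Bois_Reymond[OF \<open>T > 0\<close> _ _ \<open>t \<in> {0..T}\<close>])
    show "continuous_on {0..T} (\<lambda>t. U t - I t)" by (intro continuous_intros U cI)
    fix \<phi> assume \<phi>: "\<phi> \<in> test_fun T"
    let ?d = "\<lambda>t. vector_derivative \<phi> (at t)"
    have "((\<lambda>t. I t * ?d t + G t * \<phi> t) has_integral I T * \<phi> T - I 0 * \<phi> 0) {0..T}"
      using \<open>T > 0\<close>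
      by (intro fundamental_theorem_of_calculus has_vector_derivative_mult dI
          has_vector_derivative_at_within[OF test_fun_has_vector_derivative[OF \<phi>]]) auto
    then have "integral {0..T} (\<lambda>t. I t * ?d t + G t * \<phi> t) = 0"
      by (simp add: test_fun_boundary[OF \<phi>] integral_unique)
    moreover have "(\<lambda>t. U t * ?d t) integrable_on {0..T}" "(\<lambda>t. I t * ?d t) integrable_on {0..T}"
      "(\<lambda>t. G t * \<phi> t) integrable_on {0..T}"
      by (intro integrable_continuous_real continuous_intros U cI G test_fun_continuous[OF \<phi>])+
    ultimately show "integral {0..T} (\<lambda>t. (U t - I t) * ?d t) = 0"
      using weak[OF \<phi>]
      by (simp add: left_diff_distrib integral_add integral_diff) (metis add_right_cancel)
  qed
  then show ?thesis by (simp add: I_def algebra_simps)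
qed

section \<open>Integration of periodic functions\<close>

definition torus_integral :: "(real ^ 'n::finite \<Rightarrow> complex) \<Rightarrow> complex" where
  "torus_integral w = integral (cbox 0 (\<chi> i. 2 * pi)) w"

text \<open>The box lengthened by s in direction k is cut in two ways: at s into a slab and the
  translated box, and at 2 pi into the original box and the slab moved by one period. Periodicity
  makes both slabs contribute equally.\<close>

lemma torus_integral_translate:
  fixes w :: "real ^ 'n::finite \<Rightarrow> complex"
  assumes cont: "continuous_on UNIV w" and per: "\<And>x. w (x + (2 * pi) *\<^sub>R axis k 1) = w x"
    and s: "s \<in> {0..2 * pi}"
  shows "torus_integral (\<lambda>x. w (x + s *\<^sub>R axis k 1)) = torus_integral w"
proof -
  let ?e = "axis k 1 :: real ^ 'n" and ?P = "(\<chi> i. 2 * pi) :: real ^ 'n"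
  have e: "?e \<in> Basis" by (simp add: axis_in_Basis_iff)
  have int: "w integrable_on cbox a b" for a b
    by (intro integrable_continuous continuous_on_subset[OF cont]) auto
  let ?B = "cbox 0 (?P + s *\<^sub>R ?e)"
  have split: "integral ?B w = integral (?B \<inter> {x. x \<bullet> ?e \<le> c}) w + integral (?B \<inter> {x. x \<bullet> ?e \<ge> c}) w" for c
    by (rule integral_split[OF int e])
  let ?slab = "cbox 0 (\<chi> i. if i = k then s else 2 * pi) :: (real ^ 'n) set"
  have [simp]: "x \<bullet> ?e = x $ k" for x by (simp add: inner_axis)
  have [simp]: "?e $ i = (if i = k then 1 else 0)" for i by (simp add: axis_def)
  have mem: "x \<in> cbox a b \<longleftrightarrow> a $ k \<le> x $ k \<and> x $ k \<le> b $ k \<and>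
      (\<forall>i. i \<noteq> k \<longrightarrow> a $ i \<le> x $ i \<and> x $ i \<le> b $ i)" for x a b :: "real ^ 'n"
    by (auto simp: mem_box_cart)
  have 1: "?B \<inter> {x. x \<bullet> ?e \<le> s} = ?slab"
    using s by (auto simp: mem)
  have 2: "?B \<inter> {x. x \<bullet> ?e \<ge> s} = cbox (0 + s *\<^sub>R ?e) (?P + s *\<^sub>R ?e)"
    using s by (auto simp: mem)
  have 3: "?B \<inter> {x. x \<bullet> ?e \<le> 2 * pi} = cbox 0 ?P"
    using s by (auto simp: mem)
  have 4: "?B \<inter> {x. x \<bullet> ?e \<ge> 2 * pi} =
      cbox (0 + (2 * pi) *\<^sub>R ?e) ((\<chi> i. if i = k then s else 2 * pi) + (2 * pi) *\<^sub>R ?e)"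
    using s by (auto simp: mem)
  have shift: "integral (cbox (a + c) (b + c)) w = integral (cbox a b) (\<lambda>x. w (x + c))" for a b c
    using integral_shift_cbox[of "a + c" c "b + c" w] by simp
  show ?thesis
    using split[of s] split[of "2 * pi"] unfolding 1 2 3 4 shift per torus_integral_def by simp
qed

text \<open>By translation invariance the integral equals its average over shifts s in [0, 2 pi]
  along direction k. After swapping the integrals, the inner one is the increment of w over a full
  period, which is 0.\<close>

lemma torus_integral_partial_eq_0:
  fixes w :: "real ^ 'n::finite \<Rightarrow> complex"
  assumes cont: "continuous_on UNIV w'" and per: "\<And>x. w (x + (2 * pi) *\<^sub>R axis k 1) = w x"
    and der: "\<And>x. ((\<lambda>s. w (x + s *\<^sub>R axis k 1)) has_vector_derivative w' x) (at 0)"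
  shows "torus_integral w' = 0"
proof -
  let ?e = "axis k 1 :: real ^ 'n" and ?P = "(\<chi> i. 2 * pi) :: real ^ 'n"
  \<comment> \<open>The hypothesis differentiates only at s = 0 but for every base point; moving the
    base point gives all s.\<close>
  have der': "((\<lambda>s. w (x + s *\<^sub>R ?e)) has_vector_derivative w' (x + s *\<^sub>R ?e)) (at s)" for x s
  proof -
    have "((\<lambda>r. r - s) has_vector_derivative 1) (at s)"
      by (auto intro!: derivative_eq_intros simp flip: has_real_derivative_iff_has_vector_derivative)
    moreover have "((\<lambda>r. w (x + s *\<^sub>R ?e + r *\<^sub>R ?e)) has_vector_derivative w' (x + s *\<^sub>R ?e)) (at (s - s))"
      using der by simp
    ultimately show ?thesis
      using vector_diff_chain_at[of "\<lambda>r. r - s" 1 s "\<lambda>r. w (x + s *\<^sub>R ?e + r *\<^sub>R ?e)" "w' (x + s *\<^sub>R ?e)"]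
      by (simp add: o_def add.assoc flip: scaleR_add_left)
  qed
  \<comment> \<open>\<open>w'\<close> inherits the period of \<open>w\<close> by uniqueness of
    derivatives.\<close>
  have per': "w' (x + (2 * pi) *\<^sub>R ?e) = w' x" for x
  proof -
    have "((\<lambda>s. w (x + s *\<^sub>R ?e + (2 * pi) *\<^sub>R ?e)) has_vector_derivative w' (x + (2 * pi) *\<^sub>R ?e)) (at 0)"
      using der[of "x + (2 * pi) *\<^sub>R ?e"] by (simp add: add_ac)
    with der[of x] show ?thesis unfolding per by (metis vector_derivative_unique_at)
  qed
  have "2 * pi * torus_integral w' = integral (cbox 0 (2 * pi)) (\<lambda>s. torus_integral w')"
    by (simp add: scaleR_conv_of_real)
  also have "\<dots> = integral (cbox 0 (2 * pi)) (\<lambda>s. torus_integral (\<lambda>x. w' (x + s *\<^sub>R ?e)))"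
    by (intro integral_cong torus_integral_translate[symmetric] cont per') auto
  also have "\<dots> = integral (cbox 0 ?P) (\<lambda>x. integral (cbox 0 (2 * pi)) (\<lambda>s. w' (x + s *\<^sub>R ?e)))"
    unfolding torus_integral_def
    by (rule integral_swap_continuous)
      (auto simp: case_prod_unfold intro!: continuous_intros continuous_on_compose2[OF cont])
  also have "\<dots> = integral (cbox 0 ?P) (\<lambda>x. 0)"
  proof (rule integral_cong)
    fix x :: "real ^ 'n"
    have "((\<lambda>s. w' (x + s *\<^sub>R ?e)) has_integral w (x + (2 * pi) *\<^sub>R ?e) - w (x + 0 *\<^sub>R ?e)) {0..2 * pi}"
      by (rule fundamental_theorem_of_calculus) (auto intro: has_vector_derivative_at_within[OF der'])
    then show "integral (cbox 0 (2 * pi)) (\<lambda>s. w' (x + s *\<^sub>R ?e)) = 0"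
      by (simp add: per integral_unique)
  qed
  finally show ?thesis by simp
qed

section \<open>Continuity of derivatives in time and space\<close>

lemma coords_enumerate: "distinct (coords :: 'n::finite list)" "set (coords :: 'n list) = UNIV"
proof -
  have "distinct (coords :: 'n list) \<and> set (coords :: 'n list) = UNIV"
    unfolding coords_def
  proof (rule someI_ex)
    show "\<exists>js :: 'n list. distinct js \<and> set js = UNIV"
      using finite_distinct_list[OF finite] by blast
  qed
  then show "distinct (coords :: 'n list)" "set (coords :: 'n list) = UNIV" by blast+
qed

text \<open>The operator involves only repeated derivatives in a single direction. These are
  multi-indices supported at \<open>k\<close>, so the norm bounds apply to them without commuting
  derivatives.\<close>

lemma Dx_power_eq_Dmulti:
  fixes k :: "'n::finite"
  shows "(Dx k ^^ r) f = Dmulti (\<lambda>j. if j = k then r else 0) f"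
    and "msize (\<lambda>j. if j = k then r else 0) = r"
proof -
  have conc: "concat (map (\<lambda>j. replicate (if j = k then r else 0) j) js) =
      (if k \<in> set js then replicate r k else [])" if "distinct js" for js
    using that
  proof (induction js)
    case (Cons i js)
    then show ?case by (cases "i = k") auto
  qed simp
  then show "(Dx k ^^ r) f = Dmulti (\<lambda>j. if j = k then r else 0) f"
    unfolding Dmulti_eq_foldr conc[OF coords_enumerate(1)] coords_enumerate(2) by simp
  show "msize (\<lambda>j. if j = k then r else 0) = r" by (simp add: msize_def)
qed

lemma partial_deriv_power_lincomb:
  assumes "smooth f" "smooth g"
  shows "(partial_deriv k ^^ r) (\<lambda>x. a * f x + b * g x) =
    (\<lambda>x. a * (partial_deriv k ^^ r) f x + b * (partial_deriv k ^^ r) g x)"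
  using foldr_partial_deriv_lincomb[OF assms, of "replicate r k"] by simp

lemma smooth_continuous_partial_deriv_power:
  assumes "smooth f"
  shows "continuous_on A ((partial_deriv k ^^ r) f)"
proof -
  have "continuous_on UNIV (foldr partial_deriv (replicate r k) f)"
    using assms unfolding smooth_def by blast
  then show ?thesis by (auto intro: continuous_on_subset)
qed

lemma cmod_partial_deriv_power_le:
  assumes "v \<in> omega_step h" "h > 0" "omega_norm h v < ennreal e"
  shows "cmod ((partial_deriv k ^^ r) v x) \<le> e * (h ^ r * fact r)"
proof -
  have sm: "smooth v" using assms(1) unfolding omega_step_def Cinf_torus_def by simp
  have "e \<ge> 0" using assms(3) by (metis ennreal_neg less_eq_real_def linorder_le_cases not_less_zero)
  then have "cmod (Dmulti \<alpha> v x) \<le> e * h ^ msize \<alpha> * fact (msize \<alpha>)" for \<alpha>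
    using omega_norm_le_iff[of h e v] assms by auto
  from this[of "\<lambda>j. if j = k then r else 0"]
  have "cmod ((Dx k ^^ r) v x) \<le> e * h ^ r * fact r"
    by (simp add: Dx_power_eq_Dmulti)
  then show ?thesis using foldr_Dx[OF sm, of "replicate r k"] by (simp add: norm_mult norm_power norm_divide)
qed

lemma Comega_smooth: "f \<in> Comega \<Longrightarrow> smooth f"
  unfolding Comega_def Cinf_torus_def by simp

text \<open>The sup norm of a derivative of order r is a continuous seminorm: on the step
  \<open>h\<close> it is at most \<open>h ^ r * fact r\<close> times the norm, which dictates the
  radius of the ball in that step.\<close>

lemma Comega_nhd0_derivative_small:
  assumes "e > 0"
  shows "Comega_nhd0 {v \<in> Comega. \<forall>x. cmod ((partial_deriv k ^^ r) v x) \<le> e}"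
    (is "Comega_nhd0 ?V")
  unfolding Comega_nhd0_def
proof (intro conjI allI impI)
  show "abs_convex ?V"
    unfolding abs_convex_def
  proof (intro ballI allI impI)
    fix f g a b assume f: "f \<in> ?V" and g: "g \<in> ?V" and ab: "cmod a + cmod b \<le> 1"
    have "cmod (a * (partial_deriv k ^^ r) f x + b * (partial_deriv k ^^ r) g x) \<le> e" for x
    proof -
      have "cmod (a * (partial_deriv k ^^ r) f x + b * (partial_deriv k ^^ r) g x)
          \<le> cmod a * e + cmod b * e"
        using f g by (intro norm_triangle_le add_mono) (auto simp: norm_mult intro: mult_left_mono)
      also have "\<dots> \<le> 1 * e" using ab assms by (subst distrib_right[symmetric]) (rule mult_right_mono, auto)
      finally show ?thesis by simp
    qed
    then show "(\<lambda>x. a * f x + b * g x) \<in> ?V"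
      using f g by (simp add: Comega_lincomb partial_deriv_power_lincomb Comega_smooth)
  qed
  fix h :: real assume h: "h > 0"
  let ?d = "e / (h ^ r * fact r)"
  have "?d > 0" using h assms by simp
  moreover have "v \<in> ?V" if "v \<in> omega_step h" "omega_norm h v < ennreal ?d" for v
  proof -
    have "cmod ((partial_deriv k ^^ r) v x) \<le> e" for x
      using cmod_partial_deriv_power_le[OF that(1) h that(2), of r k x] h by simp
    moreover have "v \<in> Comega" using that(1) h unfolding Comega_eq_Union_steps by auto
    ultimately show ?thesis by simp
  qed
  ultimately show "\<exists>\<epsilon>>0. {f \<in> omega_step h. omega_norm h f < ennreal \<epsilon>} \<subseteq> ?V" by blast
qed auto

lemma C_Comega_in_Comega:
  assumes "u \<in> C_Comega T" "t \<in> {0..T}"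
  shows "u t \<in> Comega"
  using continuous_map_image_subset_topspace[of "top_of_set {0..T}" Comega_topology u] assms
  unfolding C_Comega_def topspace_Comega_topology by auto

text \<open>Continuity into the inductive limit is used only through this consequence: each
  derivative depends continuously on time, uniformly in x.\<close>

lemma C_Comega_uniform_derivative:
  assumes "u \<in> C_Comega T" "t0 \<in> {0..T}" "e > 0"
  obtains d where "d > 0" "\<And>t x. t \<in> {0..T} \<Longrightarrow> dist t t0 < d \<Longrightarrow>
    cmod ((partial_deriv k ^^ r) (u t) x - (partial_deriv k ^^ r) (u t0) x) < e"
proof -
  let ?D = "partial_deriv k ^^ r"
  \<comment> \<open>The bound \<eta> < e is uniform in x, so a perturbation of size (e - \<eta>) / 2
    stays in the set; this makes it open.\<close>
  let ?O = "{w \<in> Comega. \<exists>\<eta><e. \<forall>x. cmod (?D w x - ?D (u t0) x) \<le> \<eta>}"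
  have "openin Comega_topology ?O"
    unfolding openin_Comega_topology
  proof (intro conjI ballI)
    fix w assume "w \<in> ?O"
    then obtain \<eta> where w: "w \<in> Comega" and \<eta>: "\<eta> < e" "\<And>x. cmod (?D w x - ?D (u t0) x) \<le> \<eta>" by blast
    let ?V = "{v \<in> Comega. \<forall>x. cmod (?D v x) \<le> (e - \<eta>) / 2}"
    have "(\<lambda>x. w x + v x) \<in> ?O" if v: "v \<in> ?V" for v
    proof -
      have "?D (\<lambda>x. 1 * w x + 1 * v x) = (\<lambda>x. 1 * ?D w x + 1 * ?D v x)"
        using w v by (intro partial_deriv_power_lincomb Comega_smooth) auto
      then have D: "?D (\<lambda>x. w x + v x) x = ?D w x + ?D v x" for x by simp
      have "cmod (?D (\<lambda>x. w x + v x) x - ?D (u t0) x) \<le> \<eta> + (e - \<eta>) / 2" for x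
      proof -
        have "cmod (?D w x - ?D (u t0) x + ?D v x) \<le> \<eta> + (e - \<eta>) / 2"
          using \<eta>(2)[of x] v by (intro norm_triangle_le add_mono) auto
        moreover have "?D w x - ?D (u t0) x + ?D v x = ?D (\<lambda>x. w x + v x) x - ?D (u t0) x"
          unfolding D by simp
        ultimately show ?thesis by simp
      qed
      moreover have "\<eta> + (e - \<eta>) / 2 < e" using \<eta>(1) by (simp add: field_simps)
      moreover have "(\<lambda>x. w x + v x) \<in> Comega" using Comega_lincomb[OF w, of v 1 1] v by simp
      ultimately show ?thesis by blast
    qed
    moreover have "Comega_nhd0 ?V" using \<eta>(1) by (intro Comega_nhd0_derivative_small) simp
    ultimately show "\<exists>V. Comega_nhd0 V \<and> (\<forall>v\<in>V. (\<lambda>x. w x + v x) \<in> ?O)" by blast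
  qed auto
  then have "openin (top_of_set {0..T}) {t \<in> topspace (top_of_set {0..T}). u t \<in> ?O}"
    using assms(1) unfolding C_Comega_def by (intro openin_continuous_map_preimage) auto
  moreover have "t0 \<in> {t \<in> topspace (top_of_set {0..T}). u t \<in> ?O}"
    using assms(2,3) C_Comega_in_Comega[OF assms(1)] by auto
  ultimately obtain d where "d > 0" and d: "ball t0 d \<inter> {0..T} \<subseteq> {t \<in> topspace (top_of_set {0..T}). u t \<in> ?O}"
    unfolding openin_contains_ball by meson
  show ?thesis
  proof (rule that[OF \<open>d > 0\<close>])
    fix t x assume "t \<in> {0..T}" "dist t t0 < d"
    then have "t \<in> ball t0 d \<inter> {0..T}" by (auto simp: dist_commute)
    then have "u t \<in> ?O" using d by blast
    then show "cmod (?D (u t) x - ?D (u t0) x) < e" by (auto intro: le_less_trans)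
  qed
qed

text \<open>Continuity in t that is uniform in x combines with continuity in x at the fixed time
  \<open>t0\<close> by the triangle inequality.\<close>

lemma C_Comega_derivative_jointly_continuous:
  assumes "u \<in> C_Comega T"
  shows "continuous_on ({0..T} \<times> UNIV) (\<lambda>(t, x). (partial_deriv k ^^ r) (u t) x)"
proof -
  let ?D = "partial_deriv k ^^ r"
  have "\<exists>d>0. \<forall>p\<in>{0..T} \<times> UNIV. dist p (t0, x0) < d \<longrightarrow>
      dist (?D (u (fst p)) (snd p)) (?D (u t0) x0) < e"
    if t0: "t0 \<in> {0..T}" and "e > 0" for t0 x0 e
  proof -
    obtain d1 where d1: "d1 > 0" "\<And>t x. t \<in> {0..T} \<Longrightarrow> dist t t0 < d1 \<Longrightarrow>
        cmod (?D (u t) x - ?D (u t0) x) < e / 2"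
      using C_Comega_uniform_derivative[OF assms t0, of "e / 2" r k] \<open>e > 0\<close> by auto
    have "u t0 \<in> Comega" by (rule C_Comega_in_Comega[OF assms t0])
    then have "continuous (at x0) (?D (u t0))"
      using smooth_continuous_partial_deriv_power[of "u t0" UNIV] Comega_smooth
      by (auto simp: continuous_on_eq_continuous_at)
    then obtain d2 where d2: "d2 > 0" "\<And>x. dist x x0 < d2 \<Longrightarrow> dist (?D (u t0) x) (?D (u t0) x0) < e / 2"
      unfolding continuous_at_eps_delta using \<open>e > 0\<close> by (meson half_gt_zero)
    have "dist (?D (u t) x) (?D (u t0) x0) < e" if "t \<in> {0..T}" "dist (t, x) (t0, x0) < min d1 d2" for t x
    proof -
      have "dist t t0 < d1" "dist x x0 < d2"
        using that(2) dist_fst_le[of "(t, x)" "(t0, x0)"] dist_snd_le[of "(t, x)" "(t0, x0)"] by auto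
      then have "dist (?D (u t) x) (?D (u t0) x) < e / 2" "dist (?D (u t0) x) (?D (u t0) x0) < e / 2"
        using d1(2)[OF that(1)] d2(2) by (auto simp: dist_norm)
      then show ?thesis
        using dist_triangle[of "?D (u t) x" "?D (u t0) x0" "?D (u t0) x"] by linarith
    qed
    then show ?thesis using d1(1) d2(1) by (intro exI[of _ "min d1 d2"]) auto
  qed
  then show ?thesis
    unfolding continuous_on_iff by (auto simp: case_prod_unfold)
qed

section \<open>An analytic function with geometric Fourier coefficients\<close>

text \<open>The series \<open>\<Sum>n. n ^ k * w ^ n\<close> is the \<open>k\<close>-fold application of the Euler operator
  \<open>w d/dw\<close> to the geometric series.\<close>

definition euler_series :: "nat \<Rightarrow> complex \<Rightarrow> complex" where
  "euler_series k w = (\<Sum>n. of_nat n ^ k * w ^ n)"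

text \<open>A single term of the exponential series is at most its sum.\<close>

lemma power_le_fact_mult_exp:
  fixes x :: real
  assumes "x \<ge> 0"
  shows "x ^ k \<le> fact k * exp x"
proof -
  have s: "(\<lambda>n. x ^ n /\<^sub>R fact n) sums exp x" by (rule exp_converges)
  have "(\<Sum>n\<in>{k}. x ^ n /\<^sub>R fact n) \<le> (\<Sum>n. x ^ n /\<^sub>R fact n)"
    using assms by (intro sum_le_suminf sums_summable[OF s]) auto
  also have "\<dots> = exp x" by (rule sums_unique[OF s, symmetric])
  finally show ?thesis by (simp add: field_simps)
qed

text \<open>The decay exp(-rn) is split into halves: one absorbs n^k at the cost
  \<open>fact k * (2 / r) ^ k\<close>, exactly the growth allowed for analytic functions, and the
  other leaves a geometric series.\<close>

lemma euler_series_term_bound: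
  fixes w :: complex
  assumes "r > 0" "cmod w \<le> exp (- r)"
  shows "cmod (of_nat n ^ k * w ^ n) \<le> fact k * (2 / r) ^ k * exp (- r / 2) ^ n"
proof -
  have "real n ^ k = (2 / r) ^ k * (r * n / 2) ^ k"
    using assms(1) by (simp flip: power_mult_distrib)
  also have "\<dots> \<le> (2 / r) ^ k * (fact k * exp (r * n / 2))"
    using assms(1) by (intro mult_left_mono power_le_fact_mult_exp) auto
  finally have "real n ^ k * cmod w ^ n \<le> (2 / r) ^ k * (fact k * exp (r * n / 2)) * exp (- r) ^ n"
    using assms by (intro mult_mono power_mono) auto
  also have "exp (r * n / 2) * exp (- r) ^ n = exp (- r / 2) ^ n"
    by (simp flip: exp_of_nat_mult exp_add add: field_simps)
  then have "(2 / r) ^ k * (fact k * exp (r * n / 2)) * exp (- r) ^ n = fact k * (2 / r) ^ k * exp (- r / 2) ^ n"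
    by (simp add: mult_ac)
  finally show ?thesis by (simp add: norm_mult norm_power)
qed

lemma euler_series_summable:
  assumes "cmod w < 1"
  shows "summable (\<lambda>n. of_nat n ^ k * w ^ n)"
proof -
  \<comment> \<open>exp(-r) is the midpoint between |w| and 1, a choice that also covers w =
    0.\<close>
  define r where "r = - ln ((1 + cmod w) / 2)"
  have "(1 + cmod w) / 2 > 0" by (simp add: add_pos_nonneg)
  then have e: "exp (- r) = (1 + cmod w) / 2" by (simp add: r_def)
  have r: "r > 0" using assms \<open>(1 + cmod w) / 2 > 0\<close> by (simp add: r_def ln_less_zero)
  have w: "cmod w \<le> exp (- r)" using assms unfolding e by simp
  have "summable (\<lambda>n. fact k * (2 / r) ^ k * exp (- r / 2) ^ n)"
    using r by (intro summable_mult summable_geometric) simp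
  then show ?thesis
    by (rule summable_comparison_test') (rule euler_series_term_bound[OF r w])
qed

lemma euler_series_bound:
  assumes "r > 0" "cmod w \<le> exp (- r)"
  shows "cmod (euler_series k w) \<le> fact k * (2 / r) ^ k * (1 / (1 - exp (- r / 2)))"
proof -
  have g: "(\<lambda>n. fact k * (2 / r) ^ k * exp (- r / 2) ^ n) sums (fact k * (2 / r) ^ k * (1 / (1 - exp (- r / 2))))"
    using assms by (intro sums_mult geometric_sums) simp
  have "cmod (\<Sum>n. of_nat n ^ k * w ^ n) \<le> (\<Sum>n. fact k * (2 / r) ^ k * exp (- r / 2) ^ n)"
    by (rule norm_suminf_le[OF euler_series_term_bound[OF assms] sums_summable[OF g]])
  then show ?thesis unfolding euler_series_def sums_unique[OF g] .
qed

text \<open>Termwise differentiation. The conclusion concerns w D, which avoids dividing by w and is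
  the form in which the chain rule along a plane wave produces it.\<close>

lemma euler_series_derivative:
  assumes "cmod w < 1"
  shows "\<exists>D. (euler_series k has_field_derivative D) (at w) \<and> w * D = euler_series (Suc k) w"
proof -
  let ?c = "\<lambda>n. of_nat n ^ k :: complex"
  have "(euler_series k has_field_derivative (\<Sum>n. diffs ?c n * w ^ n)) (at w)"
    unfolding euler_series_def[abs_def]
    by (rule termdiffs_strong'[of 1]) (use assms euler_series_summable in auto)
  moreover have "summable (\<lambda>n. diffs ?c n * w ^ n)"
    by (rule termdiff_converges[OF assms]) (rule euler_series_summable)
  then have "(\<lambda>n. w * (of_nat n * ?c n * w ^ (n - Suc 0))) sums (w * (\<Sum>n. diffs ?c n * w ^ n))"
    by (intro sums_mult diffs_equiv)
  moreover have "w * (of_nat n * ?c n * w ^ (n - Suc 0)) = of_nat n ^ Suc k * w ^ n" for n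
    by (cases n) (auto simp: mult_ac)
  ultimately show ?thesis unfolding euler_series_def by (metis (no_types, lifting) sums_cong sums_unique)
qed

section \<open>Plane waves and the analytic source\<close>

definition plane_wave :: "real \<Rightarrow> 'n::finite \<Rightarrow> real ^ 'n \<Rightarrow> complex" where
  "plane_wave \<kappa> j x = exp (\<i> * of_real (\<kappa> * x $ j))"

lemma norm_plane_wave [simp]: "cmod (plane_wave \<kappa> j x) = 1"
  by (simp add: plane_wave_def)

lemma plane_wave_has_vector_derivative:
  "((\<lambda>s. plane_wave \<kappa> j (x + s *\<^sub>R axis k 1)) has_vector_derivative
    (if k = j then \<i> * of_real \<kappa> * plane_wave \<kappa> j x else 0)) (at 0)"
proof (cases "k = j")
  case True
  have "((\<lambda>s. exp (\<i> * (of_real \<kappa> * (of_real (x $ j) + s)))) has_field_derivative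
      \<i> * of_real \<kappa> * exp (\<i> * (of_real \<kappa> * (of_real (x $ j) + 0)))) (at (of_real 0))"
    by (auto intro!: derivative_eq_intros)
  from has_vector_derivative_real_field[OF this] True show ?thesis
    by (simp add: plane_wave_def axis_def)
next
  case False
  then show ?thesis by (simp add: plane_wave_def axis_def)
qed

lemma plane_wave_continuous [continuous_intros]: "continuous_on A (plane_wave \<kappa> j)"
  unfolding plane_wave_def by (intro continuous_intros)

lemma plane_wave_periodic:
  assumes "\<kappa> \<in> \<int>"
  shows "plane_wave \<kappa> j (x + (2 * pi) *\<^sub>R axis k 1) = plane_wave \<kappa> j x"
proof (cases "k = j")
  case True
  obtain m :: int where m: "\<kappa> = of_int m" using assms by (auto elim: Ints_cases)
  have "plane_wave \<kappa> j (x + (2 * pi) *\<^sub>R axis k 1) = exp (\<i> * of_real (\<kappa> * x $ j) + \<i> * of_int m * (of_real pi * 2))"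
    unfolding plane_wave_def using True m by (simp add: axis_def algebra_simps)
  then show ?thesis
    unfolding plane_wave_def exp_add using exp_integer_2pi[of "of_int m"] by (simp add: mult_ac)
next
  case False
  then show ?thesis by (simp add: plane_wave_def axis_def)
qed

text \<open>For \<open>k = 0\<close> this is the source F. The index \<open>k\<close> counts
  applications of the Euler operator, so that derivatives stay in the family up to
  constants.\<close>

definition geometric_wave :: "real \<Rightarrow> real \<Rightarrow> 'n::finite \<Rightarrow> nat \<Rightarrow> real ^ 'n \<Rightarrow> complex" where
  "geometric_wave \<rho> \<sigma> j k x = euler_series k (of_real (exp (- \<rho>)) * plane_wave \<sigma> j x)"

lemma geometric_wave_argument:
  assumes "\<rho> > 0"
  shows "cmod (of_real (exp (- \<rho>)) * plane_wave \<sigma> j x) = exp (- \<rho>)"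
    and "cmod (of_real (exp (- \<rho>)) * plane_wave \<sigma> j x) < 1"
  using assms by (simp_all add: norm_mult)

lemma geometric_wave_has_vector_derivative:
  assumes "\<rho> > 0"
  shows "((\<lambda>s. geometric_wave \<rho> \<sigma> j k (x + s *\<^sub>R axis l 1)) has_vector_derivative
    (if l = j then \<i> * of_real \<sigma> * geometric_wave \<rho> \<sigma> j (Suc k) x else 0)) (at 0)"
proof -
  let ?z = "\<lambda>x. of_real (exp (- \<rho>)) * plane_wave \<sigma> j x"
  obtain D where D: "(euler_series k has_field_derivative D) (at (?z x))"
    "?z x * D = euler_series (Suc k) (?z x)"
    using euler_series_derivative[OF geometric_wave_argument(2)[OF assms]] by blast
  have "((\<lambda>s. ?z (x + s *\<^sub>R axis l 1)) has_vector_derivative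
      of_real (exp (- \<rho>)) * (if l = j then \<i> * of_real \<sigma> * plane_wave \<sigma> j x else 0)) (at 0)"
    by (intro has_vector_derivative_mult_right plane_wave_has_vector_derivative)
  from field_vector_diff_chain_at[OF this] D(1)
  have "((\<lambda>s. geometric_wave \<rho> \<sigma> j k (x + s *\<^sub>R axis l 1)) has_vector_derivative
      of_real (exp (- \<rho>)) * (if l = j then \<i> * of_real \<sigma> * plane_wave \<sigma> j x else 0) * D) (at 0)"
    by (simp add: geometric_wave_def[abs_def] o_def)
  moreover have "of_real (exp (- \<rho>)) * (if l = j then \<i> * of_real \<sigma> * plane_wave \<sigma> j x else 0) * D =
      (if l = j then \<i> * of_real \<sigma> * geometric_wave \<rho> \<sigma> j (Suc k) x else 0)"
    unfolding geometric_wave_def D(2)[symmetric] by (simp add: mult_ac)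
  ultimately show ?thesis by simp
qed

lemma geometric_wave_continuous:
  assumes "\<rho> > 0"
  shows "continuous_on A (geometric_wave \<rho> \<sigma> j k)"
proof -
  have "continuous_on (ball 0 1) (euler_series k)"
    using euler_series_derivative by (intro continuous_at_imp_continuous_on ballI) (metis DERIV_isCont dist_0_norm mem_ball)
  then show ?thesis
    unfolding geometric_wave_def[abs_def]
    by (rule continuous_on_compose2)
      (use geometric_wave_argument(2)[OF assms] in \<open>auto intro!: continuous_intros\<close>)
qed

text \<open>The function depends on the coordinate \<open>j\<close> alone: a word containing any
  other direction gives 0, and each letter \<open>j\<close> contributes one factor i \<sigma> and
  one Euler operator.\<close>

lemma foldr_partial_geometric_wave:
  assumes "\<rho> > 0"
  shows "foldr partial_deriv js (geometric_wave \<rho> \<sigma> j 0) =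
    (\<lambda>x. (if set js \<subseteq> {j} then (\<i> * of_real \<sigma>) ^ length js else 0) * geometric_wave \<rho> \<sigma> j (length js) x)"
proof (induction js)
  case (Cons l js)
  show ?case
  proof
    fix x
    let ?c = "if set js \<subseteq> {j} then (\<i> * of_real \<sigma>) ^ length js else 0"
    have "((\<lambda>s. ?c * geometric_wave \<rho> \<sigma> j (length js) (x + s *\<^sub>R axis l 1)) has_vector_derivative
       ?c * (if l = j then \<i> * of_real \<sigma> * geometric_wave \<rho> \<sigma> j (Suc (length js)) x else 0)) (at 0)"
      by (intro has_vector_derivative_mult_right geometric_wave_has_vector_derivative assms)
    from vector_derivative_at[OF this]
    show "foldr partial_deriv (l # js) (geometric_wave \<rho> \<sigma> j 0) x =
      (if set (l # js) \<subseteq> {j} then (\<i> * of_real \<sigma>) ^ length (l # js) else 0) *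
        geometric_wave \<rho> \<sigma> j (length (l # js)) x"
      unfolding foldr_Cons o_def Cons.IH partial_deriv_def by auto
  qed
qed simp

lemma geometric_wave_Cinf_torus:
  assumes "\<rho> > 0" "\<sigma> \<in> \<int>"
  shows "geometric_wave \<rho> \<sigma> j 0 \<in> Cinf_torus"
  unfolding Cinf_torus_def smooth_def mem_Collect_eq
proof (intro conjI allI)
  fix js
  show "continuous_on UNIV (foldr partial_deriv js (geometric_wave \<rho> \<sigma> j 0))"
    unfolding foldr_partial_geometric_wave[OF assms(1)]
    by (intro continuous_intros geometric_wave_continuous assms)
  fix l x
  show "(\<lambda>s. foldr partial_deriv js (geometric_wave \<rho> \<sigma> j 0) (x + s *\<^sub>R axis l 1)) differentiable at 0"
    unfolding foldr_partial_geometric_wave[OF assms(1)]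
    by (rule differentiableI_vector[OF has_vector_derivative_mult_right])
      (rule geometric_wave_has_vector_derivative[OF assms(1)])
next
  fix l x
  show "geometric_wave \<rho> \<sigma> j 0 (x + (2 * pi) *\<^sub>R axis l 1) = geometric_wave \<rho> \<sigma> j 0 x"
    by (simp add: geometric_wave_def plane_wave_periodic[OF assms(2)])
qed

lemma length_concat_coords:
  "length (concat (map (\<lambda>j. replicate (\<alpha> j) j) (coords :: 'n::finite list))) = msize \<alpha>"
  by (simp add: length_concat o_def msize_def sum_list_distinct_conv_sum_set coords_enumerate)

text \<open>Since |\<sigma>| = 1, the factors from differentiation have modulus at most 1, and
  \<open>euler_series_bound\<close> supplies the analytic estimate with h = 2 / \<rho>.\<close>

lemma geometric_wave_Comega:
  assumes "\<rho> > 0" "\<sigma> \<in> \<int>" "\<bar>\<sigma>\<bar> = 1"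
  shows "geometric_wave \<rho> \<sigma> j 0 \<in> Comega"
proof -
  let ?C = "1 / (1 - exp (- \<rho> / 2))"
  have "cmod (Dmulti \<alpha> (geometric_wave \<rho> \<sigma> j 0) x) \<le> ?C * (2 / \<rho>) ^ msize \<alpha> * fact (msize \<alpha>)" for \<alpha> x
  proof -
    let ?js = "concat (map (\<lambda>j. replicate (\<alpha> j) j) coords)"
    have sm: "smooth (geometric_wave \<rho> \<sigma> j 0)"
      using geometric_wave_Cinf_torus[OF assms(1,2), of j] unfolding Cinf_torus_def by blast
    have "cmod (Dmulti \<alpha> (geometric_wave \<rho> \<sigma> j 0) x) \<le> cmod (geometric_wave \<rho> \<sigma> j (length ?js) x)"
      unfolding Dmulti_eq_foldr foldr_Dx[OF sm] foldr_partial_geometric_wave[OF assms(1)]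
      by (auto simp: norm_mult norm_power norm_divide assms(3))
    also have "\<dots> \<le> fact (msize \<alpha>) * (2 / \<rho>) ^ msize \<alpha> * ?C"
      unfolding length_concat_coords geometric_wave_def
      by (intro euler_series_bound assms order_eq_refl geometric_wave_argument)
    finally show ?thesis by (simp add: mult_ac)
  qed
  moreover have "?C > 0" "2 / \<rho> > 0" using assms by auto
  ultimately show ?thesis
    unfolding Comega_def using geometric_wave_Cinf_torus[OF assms(1,2)] by blast
qed

section \<open>Fourier coefficients\<close>

lemma torus_measure:
  "measure lborel (cbox 0 (\<chi> i. 2 * pi) :: (real ^ 'n::finite) set) = (2 * pi) ^ CARD('n)"
  by (subst content_cbox_cart) (auto simp: interval_ne_empty_cart)

lemma torus_integral_const:
  "torus_integral (\<lambda>_ :: real ^ 'n::finite. c) = of_real ((2 * pi) ^ CARD('n)) * c"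
  unfolding torus_integral_def by (simp add: scaleR_conv_of_real torus_measure)

lemma torus_integral_bound:
  fixes w :: "real ^ 'n::finite \<Rightarrow> complex"
  assumes "continuous_on UNIV w" "\<And>x. x \<in> cbox 0 (\<chi> i. 2 * pi) \<Longrightarrow> cmod (w x) \<le> B" "B \<ge> 0"
  shows "cmod (torus_integral w) \<le> B * (2 * pi) ^ CARD('n)"
proof -
  have "(w has_integral torus_integral w) (cbox 0 (\<chi> i. 2 * pi))"
    unfolding torus_integral_def
    by (intro integrable_integral integrable_continuous continuous_on_subset[OF assms(1)]) auto
  from has_integral_bound[OF assms(3) this] assms(2) show ?thesis by (simp add: torus_measure)
qed

text \<open>The Fourier coefficient at frequency \<kappa> in direction \<open>j\<close>, left
  unnormalized; hence the factors (2 pi)^N below.\<close>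

definition torus_coeff :: "real \<Rightarrow> 'n::finite \<Rightarrow> (real ^ 'n \<Rightarrow> complex) \<Rightarrow> complex" where
  "torus_coeff \<kappa> j v = torus_integral (\<lambda>x. v x * plane_wave (- \<kappa>) j x)"

lemma torus_coeff_integrable:
  assumes "continuous_on UNIV v"
  shows "(\<lambda>x. v x * plane_wave (- \<kappa>) j x) integrable_on cbox a b"
  by (intro integrable_continuous continuous_intros continuous_on_subset[OF assms]) auto

lemma torus_coeff_add:
  assumes "continuous_on UNIV v" "continuous_on UNIV w"
  shows "torus_coeff \<kappa> j (\<lambda>x. v x + w x) = torus_coeff \<kappa> j v + torus_coeff \<kappa> j w"
  unfolding torus_coeff_def torus_integral_def
  by (simp add: distrib_right integral_add torus_coeff_integrable assms)

lemma torus_coeff_cmult: "torus_coeff \<kappa> j (\<lambda>x. c * v x) = c * torus_coeff \<kappa> j v"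
  unfolding torus_coeff_def torus_integral_def by (simp add: mult.assoc)

lemma torus_coeff_sum:
  assumes "finite S" "\<And>k. k \<in> S \<Longrightarrow> continuous_on UNIV (v k)"
  shows "torus_coeff \<kappa> j (\<lambda>x. \<Sum>k\<in>S. v k x) = (\<Sum>k\<in>S. torus_coeff \<kappa> j (v k))"
  unfolding torus_coeff_def torus_integral_def sum_distrib_right
  by (intro integral_sum torus_coeff_integrable assms)

lemma Cinf_torus_partial_deriv:
  assumes "v \<in> Cinf_torus"
  shows "partial_deriv k v \<in> Cinf_torus"
proof -
  have v: "smooth v" "\<And>j x. v (x + (2 * pi) *\<^sub>R axis j 1) = v x"
    using assms unfolding Cinf_torus_def by auto
  have "smooth (partial_deriv k v)"
    unfolding smooth_def
  proof
    fix js
    show "continuous_on UNIV (foldr partial_deriv js (partial_deriv k v)) \<and>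
        (\<forall>j x. (\<lambda>s. foldr partial_deriv js (partial_deriv k v) (x + s *\<^sub>R axis j 1)) differentiable at 0)"
      using v(1)[unfolded smooth_def, rule_format, of "js @ [k]"] by simp
  qed
  moreover have "partial_deriv k v (x + (2 * pi) *\<^sub>R axis j 1) = partial_deriv k v x" for j x
  proof -
    have "v (x + (2 * pi) *\<^sub>R axis j 1 + s *\<^sub>R axis k 1) = v (x + s *\<^sub>R axis k 1)" for s
      using v(2)[of "x + s *\<^sub>R axis k 1" j] by (simp add: add_ac)
    then show ?thesis unfolding partial_deriv_def by simp
  qed
  ultimately show ?thesis unfolding Cinf_torus_def by simp
qed

lemma smooth_has_partial_deriv:
  assumes "smooth v"
  shows "((\<lambda>s. v (x + s *\<^sub>R axis k 1)) has_vector_derivative partial_deriv k v x) (at 0)"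
  using assms[unfolded smooth_def, rule_format, of "[]"]
  unfolding partial_deriv_def vector_derivative_works[symmetric] by simp

text \<open>Integration by parts: the derivative of the periodic product of v and the conjugate
  plane wave integrates to 0. The wave varies in direction \<open>j\<close> only.\<close>

lemma torus_coeff_partial_deriv:
  assumes v: "v \<in> Cinf_torus" and "\<kappa> \<in> \<int>"
  shows "torus_coeff \<kappa> j (partial_deriv k v) = (if k = j then \<i> * of_real \<kappa> * torus_coeff \<kappa> j v else 0)"
proof -
  let ?E = "plane_wave (- \<kappa>) j"
  let ?c = "if k = j then - (\<i> * of_real \<kappa>) else 0"
  have sm: "smooth v" and per: "\<And>j x. v (x + (2 * pi) *\<^sub>R axis j 1) = v x"
    using v unfolding Cinf_torus_def by auto
  have cont: "continuous_on UNIV v" "continuous_on UNIV (partial_deriv k v)"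
    using smooth_continuous_partial_deriv_power[OF sm, of _ 0]
      smooth_continuous_partial_deriv_power[OF sm, of _ 1] by auto
  have "torus_integral (\<lambda>x. v x * (?c * ?E x) + partial_deriv k v x * ?E x) = 0"
  proof (rule torus_integral_partial_eq_0[of _ "\<lambda>x. v x * ?E x" k])
    show "continuous_on UNIV (\<lambda>x. v x * (?c * ?E x) + partial_deriv k v x * ?E x)"
      by (intro continuous_intros cont)
    show "v (x + (2 * pi) *\<^sub>R axis k 1) * ?E (x + (2 * pi) *\<^sub>R axis k 1) = v x * ?E x" for x
      using assms(2) by (simp add: per plane_wave_periodic)
    show "((\<lambda>s. v (x + s *\<^sub>R axis k 1) * ?E (x + s *\<^sub>R axis k 1)) has_vector_derivative
        v x * (?c * ?E x) + partial_deriv k v x * ?E x) (at 0)" for x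
      using has_vector_derivative_mult[OF smooth_has_partial_deriv[OF sm, of x k]
          plane_wave_has_vector_derivative[of "- \<kappa>" j x k]]
      by (simp split: if_splits)
  qed
  moreover have "(\<lambda>x. v x * (?c * ?E x) + partial_deriv k v x * ?E x) =
      (\<lambda>x. (?c * v x + partial_deriv k v x) * ?E x)"
    by (simp only: algebra_simps)
  ultimately have "torus_coeff \<kappa> j (\<lambda>x. ?c * v x + partial_deriv k v x) = 0"
    unfolding torus_coeff_def by simp
  moreover have "torus_coeff \<kappa> j (\<lambda>x. ?c * v x + partial_deriv k v x) =
      ?c * torus_coeff \<kappa> j v + torus_coeff \<kappa> j (partial_deriv k v)"
    by (subst torus_coeff_add) (auto intro!: continuous_intros cont simp: torus_coeff_cmult)
  ultimately show ?thesis by (simp add: eq_neg_iff_add_eq_0 add.commute split: if_splits)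
qed

text \<open>For \<kappa> \<noteq> 0 the wave is, up to the factor i \<kappa>, its own derivative,
  and derivatives of periodic functions integrate to 0.\<close>

lemma torus_integral_plane_wave:
  assumes "\<kappa> \<in> \<int>"
  shows "torus_integral (plane_wave \<kappa> (j :: 'n::finite)) =
    (if \<kappa> = 0 then of_real ((2 * pi) ^ CARD('n)) else 0)"
proof (cases "\<kappa> = 0")
  case True
  then have "plane_wave \<kappa> j = (\<lambda>_. 1)" by (auto simp: plane_wave_def)
  then show ?thesis using True torus_integral_const[where 'n = 'n and c = 1] by simp
next
  case False
  have "torus_integral (\<lambda>x. \<i> * of_real \<kappa> * plane_wave \<kappa> j x) = 0"
    by (rule torus_integral_partial_eq_0[of _ "plane_wave \<kappa> j" j])
      (use plane_wave_has_vector_derivative[of \<kappa> j _ j] plane_wave_periodic[OF assms] in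
        \<open>auto intro!: continuous_intros\<close>)
  with False show ?thesis by (simp add: torus_integral_def)
qed

text \<open>The series converges uniformly by the M-test, so it may be integrated term by term;
  orthogonality leaves only the term m = n.\<close>

lemma torus_coeff_geometric_wave:
  assumes "\<rho> > 0" "\<sigma> \<in> \<int>" "\<sigma> \<noteq> 0"
  shows "torus_coeff (real n * \<sigma>) j (geometric_wave \<rho> \<sigma> (j :: 'n::finite) 0) =
    of_real (exp (- \<rho>) ^ n * (2 * pi) ^ CARD('n))"
proof -
  let ?q = "exp (- \<rho>)" and ?E = "plane_wave (- (real n * \<sigma>)) j"
  let ?h = "\<lambda>m x. (of_real ?q * plane_wave \<sigma> j x) ^ m * ?E x"
  let ?B = "cbox 0 (\<chi> i. 2 * pi) :: (real ^ 'n) set"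
  have h: "?h m = (\<lambda>x. of_real (?q ^ m) * plane_wave ((real m - real n) * \<sigma>) j x)" for m
  proof
    fix x
    have "plane_wave \<sigma> j x ^ m * ?E x = plane_wave ((real m - real n) * \<sigma>) j x"
      unfolding plane_wave_def by (simp flip: exp_of_nat_mult exp_add add: algebra_simps)
    then show "?h m x = of_real (?q ^ m) * plane_wave ((real m - real n) * \<sigma>) j x"
      by (simp add: power_mult_distrib mult.assoc)
  qed
  have "uniform_limit ?B (\<lambda>M x. \<Sum>m<M. ?h m x) (\<lambda>x. \<Sum>m. ?h m x) sequentially"
    by (rule Weierstrass_m_test[where M = "\<lambda>m. ?q ^ m"])
      (use assms in \<open>auto simp: norm_mult norm_power intro!: summable_geometric\<close>)
  moreover have "(\<Sum>m. ?h m x) = geometric_wave \<rho> \<sigma> j 0 x * ?E x" for x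
    unfolding geometric_wave_def euler_series_def
    using euler_series_summable[OF geometric_wave_argument(2)[OF assms(1)], of 0 \<sigma> j x]
    by (simp add: suminf_mult2)
  moreover have cont: "continuous_on A (?h m)" for A m
    by (intro continuous_intros)
  ultimately obtain I J where I: "\<And>M. ((\<lambda>x. \<Sum>m<M. ?h m x) has_integral I M) ?B"
    and J: "((\<lambda>x. geometric_wave \<rho> \<sigma> j 0 x * ?E x) has_integral J) ?B" and lim: "I \<longlonglongrightarrow> J"
    by (auto elim!: uniform_limit_integral_cbox[OF _ continuous_on_sum])
  have summand: "integral ?B (?h m) = (if m = n then of_real (?q ^ n * (2 * pi) ^ CARD('n)) else 0)" for m
  proof -
    have "(real m - real n) * \<sigma> \<in> \<int>" using assms by (intro Ints_mult Ints_diff) auto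
    from torus_integral_plane_wave[OF this, of j] assms(3)
    show ?thesis unfolding h torus_integral_def by auto
  qed
  have "I M = (\<Sum>m<M. if m = n then of_real (?q ^ n * (2 * pi) ^ CARD('n)) else 0)" for M
  proof -
    have "I M = integral ?B (\<lambda>x. \<Sum>m<M. ?h m x)" by (rule integral_unique[OF I, symmetric])
    also have "\<dots> = (\<Sum>m<M. integral ?B (?h m))"
      by (intro integral_sum integrable_continuous cont) auto
    also have "\<dots> = (\<Sum>m<M. if m = n then of_real (?q ^ n * (2 * pi) ^ CARD('n)) else 0)"
      by (simp only: summand)
    finally show ?thesis .
  qed
  then have "\<forall>\<^sub>F M in sequentially. I M = of_real (?q ^ n * (2 * pi) ^ CARD('n))"
    \<comment> \<open>The sum over m < M contains the index n from M = n + 1 on.\<close>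
    unfolding eventually_sequentially by (intro exI[of _ "Suc n"]) auto
  then have "I \<longlonglongrightarrow> of_real (?q ^ n * (2 * pi) ^ CARD('n))" by (rule tendsto_eventually)
  then have "J = of_real (?q ^ n * (2 * pi) ^ CARD('n))" by (rule LIMSEQ_unique[OF lim])
  then show ?thesis
    using J unfolding torus_coeff_def torus_integral_def by (simp add: integral_unique)
qed

text \<open>Fubini lets Fourier coefficients in x pass through the pairing in t, turning the weak
  equation into a scalar one for each frequency.\<close>

lemma torus_coeff_distr:
  fixes w :: "real \<Rightarrow> real ^ 'n::finite \<Rightarrow> complex"
  assumes w: "continuous_on ({0..T} \<times> UNIV) (\<lambda>(t, x). w t x)" and \<psi>: "continuous_on {0..T} \<psi>"
  shows "torus_coeff \<kappa> j (distr T w \<psi>) = integral {0..T} (\<lambda>t. torus_coeff \<kappa> j (w t) * \<psi> t)"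
    and "continuous_on UNIV (distr T w \<psi>)"
    and "continuous_on {0..T} (\<lambda>t. torus_coeff \<kappa> j (w t))"
proof -
  let ?E = "plane_wave (- \<kappa>) j" and ?P = "(\<chi> i. 2 * pi) :: real ^ 'n"
  have w1: "continuous_on (A \<times> {0..T}) (\<lambda>p. w (snd p) (fst p))" for A
    by (rule continuous_on_compose2[OF w, of _ "\<lambda>p. (snd p, fst p)", simplified])
      (auto intro!: continuous_intros)
  have w2: "continuous_on ({0..T} \<times> A) (\<lambda>p. w (fst p) (snd p))" for A
    using continuous_on_subset[OF w, of "{0..T} \<times> A"] by (auto simp: case_prod_unfold)
  have \<psi>1: "continuous_on (A \<times> {0..T}) (\<lambda>p. \<psi> (snd p))" for A :: "(real ^ 'n) set"
    by (rule continuous_on_compose2[OF \<psi>]) (auto intro!: continuous_intros)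
  have E1: "continuous_on A (\<lambda>p. ?E (fst p))" for A :: "((real ^ 'n) \<times> real) set"
    by (rule continuous_on_compose2[OF plane_wave_continuous[of UNIV]]) (auto intro!: continuous_intros)
  have E2: "continuous_on A (\<lambda>p. ?E (snd p))" for A :: "(real \<times> (real ^ 'n)) set"
    by (rule continuous_on_compose2[OF plane_wave_continuous[of UNIV]]) (auto intro!: continuous_intros)
  have "torus_coeff \<kappa> j (distr T w \<psi>) =
      integral (cbox 0 ?P) (\<lambda>x. integral (cbox 0 T) (\<lambda>t. w t x * \<psi> t * ?E x))"
    by (simp add: torus_coeff_def torus_integral_def distr_def)
  also have "\<dots> = integral (cbox 0 T) (\<lambda>t. integral (cbox 0 ?P) (\<lambda>x. w t x * \<psi> t * ?E x))"
    by (rule integral_swap_continuous)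
      (use w1 \<psi>1 E1 in \<open>auto simp: case_prod_unfold cbox_Pair_eq intro!: continuous_on_mult\<close>)
  also have "\<dots> = integral {0..T} (\<lambda>t. torus_coeff \<kappa> j (w t) * \<psi> t)"
  proof -
    have "(\<lambda>x. w t x * \<psi> t * ?E x) = (\<lambda>x. w t x * ?E x * \<psi> t)" for t by (simp add: mult_ac)
    then show ?thesis by (simp add: torus_coeff_def torus_integral_def)
  qed
  finally show "torus_coeff \<kappa> j (distr T w \<psi>) = integral {0..T} (\<lambda>t. torus_coeff \<kappa> j (w t) * \<psi> t)" .
  have "continuous_on UNIV (\<lambda>x. integral (cbox 0 T) (\<lambda>t. w t x * \<psi> t))"
    by (rule integral_continuous_on_param)
      (use w1 \<psi>1 in \<open>auto simp: case_prod_unfold intro!: continuous_on_mult\<close>)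
  then show "continuous_on UNIV (distr T w \<psi>)" by (simp add: distr_def)
  show "continuous_on {0..T} (\<lambda>t. torus_coeff \<kappa> j (w t))"
    unfolding torus_coeff_def torus_integral_def
    by (rule integral_continuous_on_param)
      (use w2 E2 in \<open>auto simp: case_prod_unfold intro!: continuous_on_mult\<close>)
qed

section \<open>Growth of the Fourier coefficients of a solution\<close>

lemma spatial_part_jointly_continuous:
  fixes c1 :: "'n::finite \<Rightarrow> real \<Rightarrow> real"
  assumes u: "u \<in> C_Comega T" and c2: "continuous_on {0..T} c2" and c1: "\<And>j. continuous_on {0..T} (c1 j)"
  shows "continuous_on ({0..T} \<times> UNIV) (\<lambda>(t, x). spatial_part c2 c1 t (u t) x)"
proof -
  have c: "continuous_on ({0..T} \<times> UNIV) (\<lambda>p :: real \<times> (real ^ 'n). c (fst p))"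
    if "continuous_on {0..T} c" for c :: "real \<Rightarrow> real"
    by (rule continuous_on_compose2[OF that]) (auto intro!: continuous_intros)
  have d: "continuous_on ({0..T} \<times> UNIV) (\<lambda>p. partial_deriv k (u (fst p)) (snd p))"
    "continuous_on ({0..T} \<times> UNIV) (\<lambda>p. partial_deriv k (partial_deriv k (u (fst p))) (snd p))" for k
    using C_Comega_derivative_jointly_continuous[OF u, of 1 k]
      C_Comega_derivative_jointly_continuous[OF u, of 2 k]
    by (simp_all add: case_prod_unfold numeral_2_eq_2)
  show ?thesis
    unfolding case_prod_unfold spatial_part_def laplacian_def Dx_def
    by (intro continuous_intros c c1 c2 d)
qed

text \<open>The symbol of the operator: only the direction \<open>j\<close> survives, the second
  derivative giving (i \<kappa>)^2 and the first giving i \<kappa>.\<close>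

lemma torus_coeff_spatial_part:
  assumes v: "v \<in> Cinf_torus" and "\<kappa> \<in> \<int>"
  shows "torus_coeff \<kappa> j (spatial_part c2 c1 t v) =
    \<i> * of_real (c2 t * \<kappa>\<^sup>2 + c1 j t * \<kappa>) * torus_coeff \<kappa> j v"
proof -
  have cont: "continuous_on UNIV w" if "w \<in> Cinf_torus" for w :: "real ^ 'a \<Rightarrow> complex"
    using smooth_continuous_partial_deriv_power[of w _ 0] that unfolding Cinf_torus_def by simp
  note p1 = cont[OF Cinf_torus_partial_deriv[OF v]]
  note p2 = cont[OF Cinf_torus_partial_deriv[OF Cinf_torus_partial_deriv[OF v]]]
  have Dx: "\<i> * of_real (c1 k t) * (1 / \<i> * p) = of_real (c1 k t) * p" for k p
  proof -
    have "\<i> * of_real (c1 k t) * (1 / \<i> * p) = (\<i> * (1 / \<i>)) * (of_real (c1 k t) * p)"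
      by (simp only: mult_ac)
    then show ?thesis by simp
  qed
  have "torus_coeff \<kappa> j (spatial_part c2 c1 t v) =
      torus_coeff \<kappa> j (\<lambda>x. - \<i> * of_real (c2 t) * (\<Sum>k\<in>UNIV. partial_deriv k (partial_deriv k v) x)) +
      torus_coeff \<kappa> j (\<lambda>x. \<Sum>k\<in>UNIV. of_real (c1 k t) * partial_deriv k v x)"
    unfolding spatial_part_def[abs_def] laplacian_def Dx_def Dx
    by (subst torus_coeff_add) (auto intro!: continuous_intros p1 p2)
  also have "\<dots> = - \<i> * of_real (c2 t) * (\<Sum>k\<in>UNIV. torus_coeff \<kappa> j (partial_deriv k (partial_deriv k v))) +
      (\<Sum>k\<in>UNIV. of_real (c1 k t) * torus_coeff \<kappa> j (partial_deriv k v))"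
    by (simp only: torus_coeff_cmult torus_coeff_sum p1 p2 finite continuous_on_mult continuous_on_const)
  also have "\<dots> = - \<i> * of_real (c2 t) * (\<i> * of_real \<kappa> * (\<i> * of_real \<kappa> * torus_coeff \<kappa> j v)) +
      of_real (c1 j t) * (\<i> * of_real \<kappa> * torus_coeff \<kappa> j v)"
    by (simp add: torus_coeff_partial_deriv[OF _ assms(2)] v Cinf_torus_partial_deriv if_distrib cong: if_cong)
  finally show ?thesis by (simp add: power2_eq_square algebra_simps)
qed

text \<open>The coefficient satisfies its scalar equation weakly; as its terms are continuous, the
  weak derivative is a classical one, one-sided at the endpoints.\<close>

lemma torus_coeff_solution:
  fixes c1 :: "'n::finite \<Rightarrow> real \<Rightarrow> real"
  assumes "T > 0" and c2: "continuous_on {0..T} c2" and c1: "\<And>j. continuous_on {0..T} (c1 j)"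
    and sol: "solves_Cauchy T c2 c1 (\<lambda>_. F) g u" and F: "F \<in> Comega" and "\<kappa> \<in> \<int>" and "t \<in> {0..T}"
  shows "((\<lambda>t. torus_coeff \<kappa> j (u t)) has_vector_derivative
    of_real (c2 t * \<kappa>\<^sup>2 + c1 j t * \<kappa>) * torus_coeff \<kappa> j (u t) + \<i> * torus_coeff \<kappa> j F) (at t within {0..T})"
proof -
  let ?U = "\<lambda>t. torus_coeff \<kappa> j (u t)" and ?m = "\<lambda>t. c2 t * \<kappa>\<^sup>2 + c1 j t * \<kappa>"
  let ?G = "\<lambda>t. of_real (?m t) * ?U t + \<i> * torus_coeff \<kappa> j F"
  have u: "u \<in> C_Comega T" using sol unfolding solves_Cauchy_def by blast
  have ju: "continuous_on ({0..T} \<times> UNIV) (\<lambda>(t, x). u t x)"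
    using C_Comega_derivative_jointly_continuous[OF u, of 0] by simp
  have js: "continuous_on ({0..T} \<times> UNIV) (\<lambda>(t, x). spatial_part c2 c1 t (u t) x)"
    by (rule spatial_part_jointly_continuous[OF u c2 c1])
  have jF: "continuous_on ({0..T} \<times> UNIV) (\<lambda>(t, x). F x)"
    unfolding case_prod_unfold
    by (rule continuous_on_compose2[OF smooth_continuous_partial_deriv_power[OF Comega_smooth[OF F], of UNIV 0, simplified]])
      (auto intro!: continuous_intros)
  have cU: "continuous_on {0..T} ?U"
    by (rule torus_coeff_distr(3)[OF ju continuous_on_const])
  have cG: "continuous_on {0..T} ?G"
    by (intro continuous_intros cU c1 c2)
  have weak: "integral {0..T} (\<lambda>t. ?U t * vector_derivative \<phi> (at t)) + integral {0..T} (\<lambda>t. ?G t * \<phi> t) = 0"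
    if \<phi>: "\<phi> \<in> test_fun T" for \<phi>
  proof -
    let ?d = "\<lambda>t. vector_derivative \<phi> (at t)"
    \<comment> \<open>Multiplication by -i passes from the equation in \<open>Dt\<close> to one for
      the ordinary derivative.\<close>
    have solve: "p + q = - \<i> * z" if "\<i> * p + \<i> * q = z" for p q z
      by (simp add: that[symmetric] distrib_left flip: mult.assoc)
    note c\<phi> = test_fun_continuous[OF \<phi>]
    have Dt: "(\<lambda>t. - Dt \<phi> t) = (\<lambda>t. \<i> * ?d t)" by (simp add: Dt_def)
    have cd: "continuous_on {0..T} (\<lambda>t. \<i> * ?d t)" by (intro continuous_intros c\<phi>)
    have "P_tilde T c2 c1 u \<phi> = distr T (\<lambda>_. F) \<phi>"
      using sol \<phi> unfolding solves_Cauchy_def by blast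
    then have "(\<lambda>x. distr T u (\<lambda>t. \<i> * ?d t) x + distr T (\<lambda>t. spatial_part c2 c1 t (u t)) \<phi> x) = distr T (\<lambda>_. F) \<phi>"
      unfolding P_tilde_def weak_Dt_def Dt .
    then have "torus_coeff \<kappa> j (distr T u (\<lambda>t. \<i> * ?d t)) +
        torus_coeff \<kappa> j (distr T (\<lambda>t. spatial_part c2 c1 t (u t)) \<phi>) = torus_coeff \<kappa> j (distr T (\<lambda>_. F) \<phi>)"
      using torus_coeff_add[OF torus_coeff_distr(2)[OF ju cd] torus_coeff_distr(2)[OF js c\<phi>(1)], of \<kappa> j] by simp
    moreover have "torus_coeff \<kappa> j (distr T u (\<lambda>t. \<i> * ?d t)) = integral {0..T} (\<lambda>t. \<i> * (?U t * ?d t))"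
      unfolding torus_coeff_distr(1)[OF ju cd] by (simp only: mult.left_commute)
    moreover have "torus_coeff \<kappa> j (distr T (\<lambda>t. spatial_part c2 c1 t (u t)) \<phi>) =
        integral {0..T} (\<lambda>t. \<i> * (of_real (?m t) * ?U t * \<phi> t))"
      unfolding torus_coeff_distr(1)[OF js c\<phi>(1)]
    proof (rule integral_cong)
      fix t assume "t \<in> {0..T}"
      then have "u t \<in> Cinf_torus" using C_Comega_in_Comega[OF u] unfolding Comega_def by blast
      then show "torus_coeff \<kappa> j (spatial_part c2 c1 t (u t)) * \<phi> t = \<i> * (of_real (?m t) * ?U t * \<phi> t)"
        by (simp add: torus_coeff_spatial_part[OF _ \<open>\<kappa> \<in> \<int>\<close>] mult_ac)
    qed
    moreover have "torus_coeff \<kappa> j (distr T (\<lambda>_. F) \<phi>) = integral {0..T} (\<lambda>t. torus_coeff \<kappa> j F * \<phi> t)"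
      by (rule torus_coeff_distr(1)[OF jF c\<phi>(1)])
    ultimately have "\<i> * integral {0..T} (\<lambda>t. ?U t * ?d t) + \<i> * integral {0..T} (\<lambda>t. of_real (?m t) * ?U t * \<phi> t)
        = torus_coeff \<kappa> j F * integral {0..T} \<phi>"
      by (simp only: integral_mult_right)
    then have eq: "integral {0..T} (\<lambda>t. ?U t * ?d t) + integral {0..T} (\<lambda>t. of_real (?m t) * ?U t * \<phi> t)
        = - \<i> * (torus_coeff \<kappa> j F * integral {0..T} \<phi>)"
      by (rule solve)
    have "(\<lambda>t. of_real (?m t) * ?U t * \<phi> t) integrable_on {0..T}" "(\<lambda>t. \<i> * torus_coeff \<kappa> j F * \<phi> t) integrable_on {0..T}"
      by (intro integrable_continuous_real continuous_intros cU c1 c2 c\<phi>)+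
    then have "integral {0..T} (\<lambda>t. ?G t * \<phi> t) = integral {0..T} (\<lambda>t. of_real (?m t) * ?U t * \<phi> t) +
        integral {0..T} (\<lambda>t. \<i> * torus_coeff \<kappa> j F * \<phi> t)"
      unfolding distrib_right by (rule integral_add)
    also have "integral {0..T} (\<lambda>t. \<i> * torus_coeff \<kappa> j F * \<phi> t) = \<i> * (torus_coeff \<kappa> j F * integral {0..T} \<phi>)"
      by (simp only: integral_mult_right mult.assoc)
    finally have G: "integral {0..T} (\<lambda>t. ?G t * \<phi> t) = integral {0..T} (\<lambda>t. of_real (?m t) * ?U t * \<phi> t) +
        \<i> * (torus_coeff \<kappa> j F * integral {0..T} \<phi>)" .
    show ?thesis unfolding G add.assoc[symmetric] eq by simp
  qed
  have eq: "?U t = ?U 0 + integral {0..t} ?G" if "t \<in> {0..T}" for t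
    by (rule weak_derivative_imp_integral[OF \<open>T > 0\<close> cU cG weak that])
  have "((\<lambda>t. ?U 0 + integral {0..t} ?G) has_vector_derivative 0 + ?G t) (at t within {0..T})"
    by (intro has_vector_derivative_add has_vector_derivative_const
        integral_has_vector_derivative cG \<open>t \<in> {0..T}\<close>)
  then show ?thesis
    using has_vector_derivative_transform[OF \<open>t \<in> {0..T}\<close> eq] by simp
qed

section \<open>Growth for a scalar linear equation\<close>

text \<open>With the integrating factor exp(-A), A a primitive of m, the product W has derivative
  exp(-A) L \<ge> 0. Hence W(a) \<ge> 0 whatever the sign of m before a, and y(b) is at least
  exp(A(b)) times the increment of W over [a, c].\<close>

lemma linear_ode_growth:
  fixes y m :: "real \<Rightarrow> real"
  assumes m: "continuous_on {0..T} m"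
    and y: "\<And>t. t \<in> {0..T} \<Longrightarrow> (y has_real_derivative m t * y t + L) (at t within {0..T})"
    and "y 0 = 0" "L \<ge> 0" "0 \<le> a" "a \<le> c" "c \<le> b" "b \<le> T" "K \<ge> 0"
    and K: "\<And>t. t \<in> {a..b} \<Longrightarrow> m t \<ge> K"
  shows "y b \<ge> L * (c - a) * exp (K * (b - c))"
proof -
  define A where "A t = integral {0..t} m" for t
  define W where "W t = exp (- A t) * y t" for t
  have A: "(A has_real_derivative m t) (at t within {0..T})" if "t \<in> {0..T}" for t
    unfolding A_def by (rule integral_has_real_derivative[OF m that])
  have W: "(W has_real_derivative exp (- A t) * L) (at t within {0..T})" if "t \<in> {0..T}" for t
    unfolding W_def
    by (rule derivative_eq_intros refl A[OF that] y[OF that])+ (simp add: algebra_simps)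
  have mvt: "\<exists>x\<in>{p..q}. f q - f p = f' x * (q - p)"
    if "\<And>t. t \<in> {0..T} \<Longrightarrow> (f has_real_derivative f' t) (at t within {0..T})" "0 \<le> p" "p \<le> q" "q \<le> T"
    for f f' :: "real \<Rightarrow> real" and p q
  proof (rule mvt_very_simple[OF \<open>p \<le> q\<close>])
    fix x assume "p \<le> x" "x \<le> q"
    then have "(f has_real_derivative f' x) (at x within {p..q})"
      using that by (intro DERIV_subset[OF that(1)]) auto
    then show "(f has_derivative (*) (f' x)) (at x within {p..q})"
      by (simp add: has_field_derivative_def)
  qed
  have "W a \<ge> 0"
    using mvt[OF W, of 0 a] assms(3-8) by (auto simp: W_def)
  obtain x where x: "x \<in> {a..c}" "W c - W a = exp (- A x) * L * (c - a)"
    using mvt[OF W, of a c] assms(3-8) by auto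
  obtain z where z: "z \<in> {x..c}" "A c - A x = m z * (c - x)"
    using mvt[OF A, of x c] x(1) assms(3-8) by auto
  obtain w where w: "w \<in> {c..b}" "A b - A c = m w * (b - c)"
    using mvt[OF A, of c b] assms(3-8) by auto
  \<comment> \<open>The source acting at the mean value point x is amplified by exp(A(b) - A(x)):
    there is no loss on [x, c] because K \<ge> 0, and a gain of at least exp(K (b - c)) on
    [c, b].\<close>
  have "A c - A x \<ge> 0" unfolding z(2) using K[of z] x z assms(3-9) by auto
  moreover have "A b - A c \<ge> K * (b - c)" unfolding w(2) using K[of w] w assms(3-9) by (auto intro!: mult_right_mono)
  ultimately have "exp (K * (b - c)) \<le> exp (A b) * exp (- A x)" by (simp flip: exp_add)
  then have "L * (c - a) * exp (K * (b - c)) \<le> L * (c - a) * (exp (A b) * exp (- A x))"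
    using assms(3-8) by (intro mult_left_mono) auto
  also have "\<dots> = exp (A b) * (W c - W a)" unfolding x(2) by (simp add: mult_ac)
  also have "\<dots> \<le> exp (A b) * W b"
  proof -
    obtain r where "W b - W c = exp (- A r) * L * (b - c)"
      using mvt[OF W, of c b] assms(3-8) by auto
    moreover have "exp (- A r) * L * (b - c) \<ge> 0" using assms(3-8) by simp
    ultimately have "W b \<ge> W c" by simp
    then show ?thesis using \<open>W a \<ge> 0\<close> by simp
  qed
  also have "\<dots> = y b" by (simp add: W_def flip: exp_add mult.assoc)
  finally show ?thesis .
qed

section \<open>The counterexample\<close>

theorem theorem5p4:
  fixes T tstar \<delta> :: real
    and c2 :: "real \<Rightarrow> real"
    and c1 :: "'n::finite \<Rightarrow> real \<Rightarrow> real"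
  assumes "T > 0"
    and "continuous_on {0..T} c2"
    and "\<And>j. continuous_on {0..T} (c1 j)"
    and "tstar \<in> {0..T}"
    and "\<delta> > 0"
    and "{tstar..tstar + \<delta>} \<subseteq> {0..T}"
    and "\<And>t. t \<in> {tstar..tstar + \<delta>} \<Longrightarrow> c2 t = 0"
    and "\<exists>j. \<exists>t\<in>{tstar..tstar + \<delta>}. c1 j t \<noteq> 0"
  shows "\<exists>f \<in> C_Comega T. \<exists>g \<in> (Comega :: (real ^ 'n \<Rightarrow> complex) set).
           \<not> (\<exists>u. solves_Cauchy T c2 c1 f g u)"
proof -
  obtain j t0 where t0: "t0 \<in> {tstar..tstar + \<delta>}" "c1 j t0 \<noteq> 0" using assms(8) by blast
  \<comment> \<open>A sign is an integer, so n \<sigma> is an admissible frequency on the torus, and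
    it makes c1 n \<sigma> positive near \<open>t0\<close>.\<close>
  define \<sigma> where "\<sigma> = sgn (c1 j t0)"
  define \<eta> where "\<eta> = \<bar>c1 j t0\<bar> / 2"
  have \<eta>: "\<eta> > 0" using t0 by (simp add: \<eta>_def)
  have \<sigma>: "\<sigma> \<in> \<int>" "\<bar>\<sigma>\<bar> = 1" "\<sigma> \<noteq> 0" using t0 by (auto simp: \<sigma>_def sgn_if)
  have "continuous (at t0 within {0..T}) (c1 j)"
    using assms(3)[of j] assms(6) t0(1) by (auto simp: continuous_on_eq_continuous_within)
  then obtain d where d: "d > 0" "\<And>t. t \<in> {0..T} \<Longrightarrow> dist t t0 < d \<Longrightarrow> dist (c1 j t) (c1 j t0) < \<eta>"
    unfolding continuous_within_eps_delta using \<eta> by blast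
  \<comment> \<open>The interval around \<open>t0\<close> is clipped to the one where
    \<open>c2\<close> vanishes and stays nondegenerate when \<open>t0\<close> is an endpoint. The
    half d / 2 keeps the closed interval inside the open ball.\<close>
  define a where "a = max tstar (t0 - d / 2)"
  define b where "b = min (tstar + \<delta>) (t0 + d / 2)"
  define c where "c = (a + b) / 2"
  have ab: "a < c" "c < b" "{a..b} \<subseteq> {tstar..tstar + \<delta>}" "0 \<le> a" "b \<le> T"
    using t0(1) d(1) assms(4-6) by (auto simp: a_def b_def c_def)
  have c1: "\<sigma> * c1 j t \<ge> \<eta>" if "t \<in> {a..b}" for t
  proof -
    have "dist t t0 < d" using that d(1) by (auto simp: a_def b_def dist_real_def)
    moreover have "t \<in> {0..T}" using that ab(4,5) by auto
    ultimately have "\<bar>c1 j t - c1 j t0\<bar> < \<bar>c1 j t0\<bar> / 2" using d(2)[of t] by (simp add: dist_real_def \<eta>_def)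
    then show ?thesis by (auto simp: \<sigma>_def \<eta>_def sgn_if abs_if split: if_splits)
  qed
  \<comment> \<open>Half of the amplification rate: the coefficients of F decay at rate \<rho> in n,
    the growth has rate 2 \<rho>, and the net rate is \<rho>.\<close>
  define \<rho> where "\<rho> = \<eta> * (b - c) / 2"
  have \<rho>: "\<rho> > 0" using \<eta> ab by (simp add: \<rho>_def)
  define F :: "real ^ 'n \<Rightarrow> complex" where "F = geometric_wave \<rho> \<sigma> j 0"
  have F: "F \<in> Comega" unfolding F_def by (rule geometric_wave_Comega[OF \<rho> \<sigma>(1,2)])
  have "\<not> solves_Cauchy T c2 c1 (\<lambda>_. F) (\<lambda>_. 0) u" for u
  proof
    assume sol: "solves_Cauchy T c2 c1 (\<lambda>_. F) (\<lambda>_. 0) u"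
    then have "u b \<in> Comega" using C_Comega_in_Comega[of u T b] ab unfolding solves_Cauchy_def by auto
    then have cont: "continuous_on A (u b)" for A
      using smooth_continuous_partial_deriv_power[OF Comega_smooth, of "u b" A 0] by simp
    have "bounded (u b ` cbox 0 (\<chi> i. 2 * pi))"
      by (intro compact_imp_bounded compact_continuous_image cont compact_cbox)
    then obtain B where B: "B > 0" "\<And>x. x \<in> cbox 0 (\<chi> i. 2 * pi) \<Longrightarrow> cmod (u b x) \<le> B"
      unfolding bounded_pos by blast
    have bound: "(c - a) * exp (\<rho> * n) \<le> B" for n :: nat
    proof -
      let ?\<kappa> = "real n * \<sigma>" and ?V = "(2 * pi) ^ CARD('n)"
      let ?U = "\<lambda>t. torus_coeff ?\<kappa> j (u t)" and ?m = "\<lambda>t. c2 t * ?\<kappa>\<^sup>2 + c1 j t * ?\<kappa>"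
      let ?L = "exp (- \<rho>) ^ n * ?V"
      have \<kappa>: "?\<kappa> \<in> \<int>" using \<sigma> by simp
      have V: "?V > 0" by simp
      have "torus_coeff ?\<kappa> j F = of_real ?L"
        unfolding F_def by (rule torus_coeff_geometric_wave[OF \<rho> \<sigma>(1,3)])
      then have U: "(?U has_vector_derivative of_real (?m t) * ?U t + \<i> * of_real ?L) (at t within {0..T})"
        if "t \<in> {0..T}" for t
        using torus_coeff_solution[OF assms(1-3) sol F \<kappa> that, of j] by simp
      \<comment> \<open>The multiplier is real and the source is i times a positive number, so the
        imaginary part obeys a real equation with positive source.\<close>
      have "?L * (c - a) * exp (n * \<eta> * (b - c)) \<le> Im (?U b)"
      proof (rule linear_ode_growth[where T = T and m = ?m])
        show "continuous_on {0..T} ?m" by (intro continuous_intros assms(2,3))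
        show "((\<lambda>t. Im (?U t)) has_real_derivative ?m t * Im (?U t) + ?L) (at t within {0..T})"
          if "t \<in> {0..T}" for t
          using bounded_linear.has_vector_derivative[OF bounded_linear_Im U[OF that]]
          by (simp add: has_real_derivative_iff_has_vector_derivative)
        show "Im (?U 0) = 0"
          using sol unfolding solves_Cauchy_def torus_coeff_def torus_integral_def by simp
        show "real n * \<eta> \<le> ?m t" if "t \<in> {a..b}" for t
        proof -
          have "real n * \<eta> \<le> real n * (\<sigma> * c1 j t)" by (intro mult_left_mono c1 that) simp
          moreover have "c2 t = 0" using that ab(3) by (intro assms(7)) auto
          ultimately show ?thesis by (simp add: mult_ac)
        qed
      qed (use ab \<eta> V in auto)
      also have "\<dots> \<le> cmod (?U b)" using abs_Im_le_cmod[of "?U b"] by linarith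
      also have "\<dots> \<le> B * ?V"
        unfolding torus_coeff_def
        by (rule torus_integral_bound) (use B in \<open>auto intro!: continuous_intros cont simp: norm_mult\<close>)
      finally have "?V * (exp (- \<rho>) ^ n * (c - a) * exp (n * \<eta> * (b - c))) \<le> ?V * B"
        by (simp add: mult_ac)
      then have "exp (- \<rho>) ^ n * (c - a) * exp (n * \<eta> * (b - c)) \<le> B"
        using V by (rule mult_left_le_imp_le)
      moreover have "exp (- \<rho>) ^ n * exp (n * \<eta> * (b - c)) = exp (\<rho> * n)"
        by (simp add: \<rho>_def flip: exp_of_nat_mult exp_add)
      ultimately show ?thesis by (metis mult.assoc mult.commute)
    qed
    \<comment> \<open>Since exp(x) \<ge> x, linear growth in n already exceeds the bound B.\<close>
    obtain n :: nat where "B / ((c - a) * \<rho>) < n" using reals_Archimedean2 by blast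
    then have "B < (c - a) * (\<rho> * n)" using ab \<rho> by (simp add: field_simps)
    also have "\<rho> * n \<le> exp (\<rho> * n)" using exp_ge_add_one_self[of "\<rho> * n"] by linarith
    then have "(c - a) * (\<rho> * n) \<le> (c - a) * exp (\<rho> * n)" using ab by (intro mult_left_mono) auto
    finally show False using bound[of n] by simp
  qed
  moreover have "(\<lambda>_. F) \<in> C_Comega T"
    unfolding C_Comega_def by (simp add: topspace_Comega_topology F)
  moreover have "(\<lambda>_. 0) \<in> (Comega :: (real ^ 'n \<Rightarrow> complex) set)"
    \<comment> \<open>The zero function is written as the combination 0 F + 0 F.\<close>
    using Comega_lincomb[OF F F, of 0 0] by simp
  ultimately show ?thesis by blast
qed

end
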